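(* For every $N\in\mathbb{N}$, the (partial) magnitude map $\mathrm{mag}$ on the set of non-empty compact subsets of $\ell_1^N$, equipped with the Hausdorff metric, is continuous at every non-empty finite subset $F\subseteq\ell_1^N$. In particular, the map $F\mapsto\mathrm{mag}(F)$ on the set of all non-empty finite subsets of $\ell_1^N$, equipped with the Hausdorff metric, is continuous.
   Context: $\mathbb{N}=\{0,1,2,\dots\}$. $\ell_1^N$ is $\mathbb{R}^N$ with the metric $d_1(x,y)=\sum_k|x_k-y_k|$. Weight measures and magnitude: a weight measure of a compact set $K\subseteq\ell_1^N$ is a finite signed Borel measure $\omega$ on $K$ with $\int_K e^{-d_1(x,a)}\,d\omega(x)=1$ for all $a\in K$; it is unique if it exists. The magnitude of $K$ is $\mathrm{mag}(K):=\omega(K)$ when $K$ admits a weight measure $\omega$; thus $\mathrm{mag}$ is a partial real-valued function on the set of non-empty compact subsets of $\ell_1^N$, with domain the sets admitting a weight measure. For a finite set $F\subseteq\ell_1^N$ the similarity matrix $Z_F=(e^{-d_1(p,q)})_{p,q\in F}$ is positive definite, so $F$ is in the domain and $\mathrm{mag}(F)$ is the sum of the components of the unique vector $w\in\mathbb{R}^F$ with $Z_F w=(1,\dots,1)^T$. Continuity of a partial map at a point of its domain means continuity at that point of its restriction to its domain (with the subspace topology). *)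

theory Defs
  imports "HOL-Analysis.Analysis"
begin

section \<open>The Hausdorff metric on the nonempty compact subsets of a metric space\<close>

context Metric_space
begin

definition nonempty_compacts :: "'a set set" where
  "nonempty_compacts = {K. compactin mtopology K \<and> K \<noteq> {}}"

text \<open>The value 0 off the nonempty compact sets is a dummy: the locale \<^locale>\<open>Metric_space\<close>
  requires the distance to be nonnegative on the whole type.\<close>

definition hausdorff_dist :: "'a set \<Rightarrow> 'a set \<Rightarrow> real" where
  "hausdorff_dist A B =
     (if A \<in> nonempty_compacts \<and> B \<in> nonempty_compacts
      then max (SUP a\<in>A. INF b\<in>B. d a b) (SUP b\<in>B. INF a\<in>A. d b a)
      else 0)"

definition hausdorff_topology :: "'a set topology" where
  "hausdorff_topology = Metric_space.mtopology nonempty_compacts hausdorff_dist"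

lemma nonempty_compactsD:
  assumes "A \<in> nonempty_compacts"
  shows "A \<noteq> {}" "A \<subseteq> M" "compactin mtopology A" "closedin mtopology A" "mbounded A"
  using assms compactin_imp_closedin Hausdorff_space_mtopology compactin_imp_mbounded
    compactin_subset_topspace[of mtopology A]
  by (auto simp: nonempty_compacts_def)

lemma INF_dist_bdd: "bdd_below ((\<lambda>b. d a b) ` B)"
  by (rule bdd_belowI2[of _ 0]) simp

lemma INF_dist_le: "b \<in> B \<Longrightarrow> (INF b\<in>B. d a b) \<le> d a b"
  by (rule cINF_lower[OF INF_dist_bdd])

lemma SUP_INF_dist_bdd:
  assumes "A \<in> nonempty_compacts" "B \<in> nonempty_compacts"
  shows "bdd_above ((\<lambda>a. INF b\<in>B. d a b) ` A)"
proof -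
  obtain b where b: "b \<in> B" "b \<in> M" using nonempty_compactsD[OF assms(2)] by auto
  obtain c r where cr: "A \<subseteq> mcball c r"
    using nonempty_compactsD(5)[OF assms(1)] by (auto simp: mbounded_def)
  have "(INF b\<in>B. d a b) \<le> r + d c b" if "a \<in> A" for a
  proof -
    have a: "a \<in> M" "c \<in> M" "d c a \<le> r" using cr that by auto
    have "d a b \<le> d a c + d c b" using a b by (intro triangle) auto
    then show ?thesis using INF_dist_le[OF b(1), of a] a commute[of a c] by linarith
  qed
  then show ?thesis by (rule bdd_aboveI2)
qed

lemma hausdorff_dist_approx:
  assumes "A \<in> nonempty_compacts" "B \<in> nonempty_compacts" "a \<in> A" "e > 0"
  shows "\<exists>b\<in>B. d a b < hausdorff_dist A B + e"
proof -
  have "(INF b\<in>B. d a b) \<le> (SUP a\<in>A. INF b\<in>B. d a b)"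
    using assms by (intro cSUP_upper SUP_INF_dist_bdd)
  also have "\<dots> \<le> hausdorff_dist A B" using assms by (simp add: hausdorff_dist_def)
  finally have "(INF b\<in>B. d a b) < hausdorff_dist A B + e" using assms by linarith
  then show ?thesis
    using cINF_less_iff[OF nonempty_compactsD(1)[OF assms(2)] INF_dist_bdd] by blast
qed

lemma hausdorff_dist_commute: "hausdorff_dist A B = hausdorff_dist B A"
  by (simp add: hausdorff_dist_def max.commute)

lemma hausdorff_dist_le:
  assumes AB: "A \<in> nonempty_compacts" "B \<in> nonempty_compacts"
    and 1: "\<And>a e. a \<in> A \<Longrightarrow> e > 0 \<Longrightarrow> \<exists>b\<in>B. d a b < r + e"
    and 2: "\<And>b e. b \<in> B \<Longrightarrow> e > 0 \<Longrightarrow> \<exists>a\<in>A. d b a < r + e"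
  shows "hausdorff_dist A B \<le> r"
proof -
  have *: "(SUP a\<in>A. INF b\<in>B. d a b) \<le> r"
    if A: "A \<in> nonempty_compacts"
      and ex: "\<And>a e. a \<in> A \<Longrightarrow> e > 0 \<Longrightarrow> \<exists>b\<in>B. d a b < r + e" for A B
  proof (rule cSUP_least)
    show "A \<noteq> {}" using A nonempty_compactsD by blast
    fix a assume a: "a \<in> A"
    show "(INF b\<in>B. d a b) \<le> r"
    proof (rule field_le_epsilon)
      fix e :: real assume "e > 0"
      then obtain b where "b \<in> B" "d a b < r + e" using ex[OF a] by blast
      then show "(INF b\<in>B. d a b) \<le> r + e" using INF_dist_le[of b B a] by linarith
    qed
  qed
  show ?thesis using *[OF AB(1) 1] *[OF AB(2) 2] AB by (simp add: hausdorff_dist_def)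
qed

lemma hausdorff_dist_nonneg: "0 \<le> hausdorff_dist A B"
proof (cases "A \<in> nonempty_compacts \<and> B \<in> nonempty_compacts")
  case True
  then obtain a where a: "a \<in> A" using nonempty_compactsD by blast
  show ?thesis
  proof (rule field_le_epsilon)
    fix e :: real assume "e > 0"
    then obtain b where "d a b < hausdorff_dist A B + e" 
      using hausdorff_dist_approx True a by blast
    then show "0 \<le> hausdorff_dist A B + e" using nonneg[of a b] by linarith
  qed
qed (auto simp: hausdorff_dist_def)

lemma hausdorff_dist_0_subset:
  assumes "A \<in> nonempty_compacts" "B \<in> nonempty_compacts" "hausdorff_dist A B = 0"
  shows "A \<subseteq> B"
proof
  fix a assume a: "a \<in> A"
  have "\<exists>b\<in>B. b \<in> mball a e" if "e > 0" for e
    using hausdorff_dist_approx[OF assms(1,2) a that] assms a nonempty_compactsD[OF assms(1)]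
      nonempty_compactsD[OF assms(2)] by auto
  then have "a \<in> mtopology closure_of B"
    using a nonempty_compactsD[OF assms(1)] unfolding metric_closure_of by auto
  then show "a \<in> B"
    using nonempty_compactsD(4)[OF assms(2)] by (simp add: closure_of_closedin)
qed

lemma hausdorff_dist_triangle:
  assumes "A \<in> nonempty_compacts" "B \<in> nonempty_compacts" "C \<in> nonempty_compacts"
  shows "hausdorff_dist A C \<le> hausdorff_dist A B + hausdorff_dist B C"
proof -
  have *: "\<exists>c\<in>C. d a c < hausdorff_dist A B + hausdorff_dist B C + e"
    if K: "A \<in> nonempty_compacts" "B \<in> nonempty_compacts" "C \<in> nonempty_compacts"
      and a: "a \<in> A" and e: "e > 0" for A B C a and e :: real
  proof -
    obtain b where b: "b \<in> B" "d a b < hausdorff_dist A B + e/2"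
      using hausdorff_dist_approx[OF K(1,2) a, of "e/2"] e by auto
    obtain c where c: "c \<in> C" "d b c < hausdorff_dist B C + e/2"
      using hausdorff_dist_approx[OF K(2,3) b(1), of "e/2"] e by auto
    have "d a c \<le> d a b + d b c"
      using a b c nonempty_compactsD(2)[OF K(1)] nonempty_compactsD(2)[OF K(2)]
        nonempty_compactsD(2)[OF K(3)] by (intro triangle) auto
    then show ?thesis using b c by (intro bexI[of _ c]) auto
  qed
  show ?thesis
    using *[OF assms] *[OF assms(3,2,1)]
    by (intro hausdorff_dist_le assms)
       (simp_all add: hausdorff_dist_commute[of C B] hausdorff_dist_commute[of B A] add.commute)
qed

lemma Metric_space_hausdorff_dist: "Metric_space nonempty_compacts hausdorff_dist"
proof
  fix A B assume K: "A \<in> nonempty_compacts" "B \<in> nonempty_compacts"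
  have self: "\<exists>b\<in>A. d a b < 0 + e" if "a \<in> A" "e > 0" for a e
    using that nonempty_compactsD(2)[OF K(1)] by (intro bexI[of _ a]) auto
  have "hausdorff_dist A A = 0"
    by (rule antisym[OF hausdorff_dist_le[OF K(1) K(1) self self] hausdorff_dist_nonneg])
  then show "hausdorff_dist A B = 0 \<longleftrightarrow> A = B"
    using hausdorff_dist_0_subset[OF K] hausdorff_dist_0_subset[OF K(2,1)]
      hausdorff_dist_commute[of A B] by auto
qed (auto intro: hausdorff_dist_nonneg hausdorff_dist_commute hausdorff_dist_triangle)

end


section \<open>Finite signed measures\<close>

definition finite_signed_measure :: "'a measure \<Rightarrow> ('a set \<Rightarrow> real) \<Rightarrow> bool" where
  "finite_signed_measure M \<omega> \<longleftrightarrow>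
     \<omega> {} = 0 \<and>
     (\<forall>A :: nat \<Rightarrow> 'a set. range A \<subseteq> sets M \<longrightarrow> disjoint_family A \<longrightarrow>
        (\<lambda>i. \<omega> (A i)) sums \<omega> (\<Union>i. A i))"

text \<open>The positive part of the Jordan decomposition; the negative part of \<open>\<omega>\<close> is the positive
  part of \<open>-\<omega>\<close>. Negative values of \<open>\<omega> B\<close>, which \<^const>\<open>ennreal\<close> truncates to 0, do not
  matter for the supremum, since \<open>B = {}\<close> contributes 0.\<close>

definition positive_variation :: "'a measure \<Rightarrow> ('a set \<Rightarrow> real) \<Rightarrow> 'a measure" where
  "positive_variation M \<omega> =
     measure_of (space M) (sets M) (\<lambda>A. SUP B\<in>{B \<in> sets M. B \<subseteq> A}. ennreal (\<omega> B))"

definition signed_integral :: "'a measure \<Rightarrow> ('a set \<Rightarrow> real) \<Rightarrow> ('a \<Rightarrow> real) \<Rightarrow> real" where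
  "signed_integral M \<omega> f =
     integral\<^sup>L (positive_variation M \<omega>) f - integral\<^sup>L (positive_variation M (\<lambda>A. - \<omega> A)) f"

lemma space_positive_variation [simp]: "space (positive_variation M \<omega>) = space M"
  and sets_positive_variation [simp]: "sets (positive_variation M \<omega>) = sets M"
  by (simp_all add: positive_variation_def space_measure_of_conv sets.sets_measure_of_eq)

lemma finite_signed_measure_Un:
  assumes "finite_signed_measure M \<omega>" "A \<in> sets M" "B \<in> sets M" "A \<inter> B = {}"
  shows "\<omega> (A \<union> B) = \<omega> A + \<omega> B"
proof -
  have "range (binaryset A B) \<subseteq> sets M" using assms by (simp add: range_binaryset_eq)
  moreover have "disjoint_family (binaryset A B)"
    using assms(4) by (auto simp: disjoint_family_on_def binaryset_def)
  ultimately have "(\<lambda>i. \<omega> (binaryset A B i)) sums \<omega> (A \<union> B)"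
    using assms(1) unfolding finite_signed_measure_def by (metis UN_binaryset_eq)
  moreover have "(\<lambda>i. \<omega> (binaryset A B i)) sums (\<omega> A + \<omega> B)"
    using assms(1) by (intro binaryset_sums) (simp add: finite_signed_measure_def)
  ultimately show ?thesis by (rule sums_unique2)
qed

lemma finite_signed_measure_uminus:
  "finite_signed_measure M \<omega> \<Longrightarrow> finite_signed_measure M (\<lambda>A. - \<omega> A)"
  unfolding finite_signed_measure_def by (auto intro: sums_minus)

lemma emeasure_positive_variation:
  assumes \<omega>: "finite_signed_measure M \<omega>" and A: "A \<in> sets M"
  shows "emeasure (positive_variation M \<omega>) A = (SUP B\<in>{B \<in> sets M. B \<subseteq> A}. ennreal (\<omega> B))"
proof -
  let ?f = "\<lambda>A. SUP B\<in>{B \<in> sets M. B \<subseteq> A}. ennreal (\<omega> B)"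
  have zero: "\<omega> {} = 0" using \<omega> by (simp add: finite_signed_measure_def)
  have upper: "ennreal (\<omega> B) \<le> ?f A" if "B \<in> sets M" "B \<subseteq> A" for A B
    using that by (intro SUP_upper) auto
  have mono: "?f A \<le> ?f B" if "A \<subseteq> B" for A B
    using that by (intro SUP_subset_mono) auto
  have add_le: "ennreal (\<omega> C) + ennreal (\<omega> D) \<le> ?f (A \<union> B)"
    if "A \<inter> B = {}" "C \<in> sets M" "C \<subseteq> A" "D \<in> sets M" "D \<subseteq> B" for A B C D
  proof -
    define C' where "C' = (if \<omega> C \<ge> 0 then C else {})"
    define D' where "D' = (if \<omega> D \<ge> 0 then D else {})"
    have CD: "C' \<in> sets M" "D' \<in> sets M" "C' \<subseteq> A" "D' \<subseteq> B" "0 \<le> \<omega> C'" "0 \<le> \<omega> D'"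
      using that zero by (auto simp: C'_def D'_def)
    have "C' \<inter> D' = {}" using CD that(1) by blast
    then have eq: "\<omega> (C' \<union> D') = \<omega> C' + \<omega> D'"
      using CD finite_signed_measure_Un[OF \<omega>] by blast
    have "ennreal (\<omega> C) + ennreal (\<omega> D) = ennreal (\<omega> C') + ennreal (\<omega> D')"
      using zero by (auto simp: C'_def D'_def ennreal_neg)
    also have "\<dots> = ennreal (\<omega> (C' \<union> D'))"
      using CD by (simp add: eq ennreal_plus)
    also have "\<dots> \<le> ?f (A \<union> B)" using CD by (intro upper) auto
    finally show ?thesis .
  qed
  have superadd: "?f A + ?f B \<le> ?f (A \<union> B)" if "A \<inter> B = {}" for A B
  proof -
    have ne: "{B \<in> sets M. B \<subseteq> X} \<noteq> {}" for X by blast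
    have "?f A + ?f B = (SUP D\<in>{D \<in> sets M. D \<subseteq> B}. ?f A + ennreal (\<omega> D))"
      by (rule ennreal_SUP_add_right[OF ne])
    also have "\<dots> \<le> ?f (A \<union> B)"
    proof (rule SUP_least)
      fix D assume D: "D \<in> {D \<in> sets M. D \<subseteq> B}"
      have "?f A + ennreal (\<omega> D) = (SUP C\<in>{C \<in> sets M. C \<subseteq> A}. ennreal (\<omega> C) + ennreal (\<omega> D))"
        by (rule ennreal_SUP_add_left[OF ne, symmetric])
      also have "\<dots> \<le> ?f (A \<union> B)"
        using D that by (intro SUP_least add_le) auto
      finally show "?f A + ennreal (\<omega> D) \<le> ?f (A \<union> B)" .
    qed
    finally show ?thesis .
  qed
  define f where "f A = ?f A" for A
  note upper = upper[folded f_def] and mono = mono[folded f_def]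
    and superadd = superadd[folded f_def]
  have "positive (sets M) f"
  proof -
    have "{B \<in> sets M. B \<subseteq> {}} = {{}}" by auto
    then show ?thesis by (simp add: positive_def zero f_def)
  qed
  moreover have "countably_additive (sets M) f"
  proof (rule countably_additiveI)
    fix A :: "nat \<Rightarrow> 'a set"
    assume rA: "range A \<subseteq> sets M" and disj: "disjoint_family A"
    show "(\<Sum>i. f (A i)) = f (\<Union>i. A i)"
    proof (rule antisym)
      have "(\<Sum>i<n. f (A i)) \<le> f (\<Union>i<n. A i)" for n
      proof (induction n)
        case (Suc n)
        have "(\<Union>i<n. A i) \<inter> A n = {}"
        proof -
          have "A i \<inter> A n = {}" if "i < n" for i
            using disjoint_family_onD[OF disj, of i n] that by simp
          then show ?thesis by blast
        qed
        then have le: "f (\<Union>i<n. A i) + f (A n) \<le> f ((\<Union>i<n. A i) \<union> A n)" by (rule superadd)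
        have "(\<Sum>i<Suc n. f (A i)) = (\<Sum>i<n. f (A i)) + f (A n)" by (rule sum.lessThan_Suc)
        also have "\<dots> \<le> f (\<Union>i<n. A i) + f (A n)" by (rule add_right_mono[OF Suc])
        also note le
        also have "(\<Union>i<n. A i) \<union> A n = (\<Union>i<Suc n. A i)" by (auto simp: less_Suc_eq)
        finally show ?case .
      qed simp
      then have "(\<Sum>i<n. f (A i)) \<le> f (\<Union>i. A i)" for n
        by (rule order_trans) (intro mono, auto)
      then show "(\<Sum>i. f (A i)) \<le> f (\<Union>i. A i)"
        by (intro suminf_le_const) auto
      show "f (\<Union>i. A i) \<le> (\<Sum>i. f (A i))"
        unfolding f_def[of "\<Union>i. A i"]
      proof (rule SUP_least)
        fix B assume B: "B \<in> {B \<in> sets M. B \<subseteq> (\<Union>i. A i)}"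
        have "(\<lambda>i. \<omega> (B \<inter> A i)) sums \<omega> (\<Union>i. B \<inter> A i)"
        proof -
          have "range (\<lambda>i. B \<inter> A i) \<subseteq> sets M" using B rA by auto
          moreover have "disjoint_family (\<lambda>i. B \<inter> A i)"
            using disj by (auto simp: disjoint_family_on_def)
          ultimately show ?thesis using \<omega> unfolding finite_signed_measure_def by blast
        qed
        moreover have "(\<Union>i. B \<inter> A i) = B" using B by auto
        ultimately have "(\<lambda>n. \<Sum>i<n. \<omega> (B \<inter> A i)) \<longlonglongrightarrow> \<omega> B" by (simp add: sums_def)
        then have lim: "(\<lambda>n. ennreal (\<Sum>i<n. \<omega> (B \<inter> A i))) \<longlonglongrightarrow> ennreal (\<omega> B)"
          by (rule tendsto_ennrealI)
        have "ennreal (\<Sum>i<n. \<omega> (B \<inter> A i)) \<le> (\<Sum>i. f (A i))" for n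
        proof -
          have "ennreal (\<Sum>i<n. \<omega> (B \<inter> A i)) \<le> ennreal (\<Sum>i<n. max 0 (\<omega> (B \<inter> A i)))"
            by (intro ennreal_leI sum_mono) simp
          also have "\<dots> = (\<Sum>i<n. ennreal (max 0 (\<omega> (B \<inter> A i))))"
            by (simp add: sum_ennreal)
          also have "\<dots> \<le> (\<Sum>i<n. f (A i))"
          proof (rule sum_mono)
            fix i
            have "ennreal (max 0 (\<omega> (B \<inter> A i))) = ennreal (\<omega> (B \<inter> A i))"
              by (simp add: max_def ennreal_neg)
            also have "\<dots> \<le> f (A i)" using B rA by (intro upper) auto
            finally show "ennreal (max 0 (\<omega> (B \<inter> A i))) \<le> f (A i)" .
          qed
          also have "\<dots> \<le> (\<Sum>i. f (A i))" by (intro sum_le_suminf) auto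
          finally show ?thesis .
        qed
        then show "ennreal (\<omega> B) \<le> (\<Sum>i. f (A i))"
          by (intro LIMSEQ_le_const2[OF lim]) auto
      qed
    qed
  qed
  ultimately have eq: "emeasure (measure_of (space M) (sets M) f) A = f A"
    using A by (intro emeasure_measure_of_sigma sets.sigma_algebra_axioms)
  have "positive_variation M \<omega> = measure_of (space M) (sets M) f"
    unfolding positive_variation_def f_def ..
  then have "emeasure (positive_variation M \<omega>) A = f A"
    by (rule ssubst) (rule eq)
  then show ?thesis unfolding f_def .
qed


section \<open>Magnitude of compact subsets of \<open>\<ell>\<^sub>1\<^sup>N\<close>\<close>

text \<open>Vectors of \<open>\<real>\<^sup>N\<close> are functions on \<^typ>\<open>nat\<close> vanishing from index \<open>N\<close> on, so that \<open>N = 0\<close>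
  (a one-point space) is included. The distance is meant for such vectors only.\<close>

definition l1_space :: "nat \<Rightarrow> (nat \<Rightarrow> real) set" where
  "l1_space N = {x. \<forall>k\<ge>N. x k = 0}"

definition l1_dist :: "nat \<Rightarrow> (nat \<Rightarrow> real) \<Rightarrow> (nat \<Rightarrow> real) \<Rightarrow> real" where
  "l1_dist N x y = (\<Sum>k<N. \<bar>x k - y k\<bar>)"

lemma Metric_space_l1: "Metric_space (l1_space N) (l1_dist N)"
proof
  fix x y assume xy: "x \<in> l1_space N" "y \<in> l1_space N"
  have "l1_dist N x y = 0 \<longleftrightarrow> (\<forall>k<N. x k = y k)"
    by (auto simp: l1_dist_def sum_nonneg_eq_0_iff)
  also have "\<dots> \<longleftrightarrow> x = y"
  proof
    assume eq: "\<forall>k<N. x k = y k"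
    have "x k = y k" for k
      using xy eq by (cases "k < N") (simp_all add: l1_space_def)
    then show "x = y" by (rule ext)
  qed simp
  finally show "l1_dist N x y = 0 \<longleftrightarrow> x = y" .
next
  fix x y z :: "nat \<Rightarrow> real"
  have "l1_dist N x z \<le> (\<Sum>k<N. \<bar>x k - y k\<bar> + \<bar>y k - z k\<bar>)"
    unfolding l1_dist_def by (intro sum_mono) linarith
  then show "l1_dist N x z \<le> l1_dist N x y + l1_dist N y z"
    by (simp add: l1_dist_def sum.distrib)
next
  fix x y :: "nat \<Rightarrow> real"
  show "0 \<le> l1_dist N x y" unfolding l1_dist_def by (rule sum_nonneg) (rule abs_ge_zero)
  show "l1_dist N x y = l1_dist N y x"
    unfolding l1_dist_def by (rule sum.cong) (rule refl, rule abs_minus_commute)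
qed

interpretation l1: Metric_space "l1_space N" "l1_dist N" for N
  by (rule Metric_space_l1)

definition l1_borel :: "nat \<Rightarrow> (nat \<Rightarrow> real) set \<Rightarrow> (nat \<Rightarrow> real) measure" where
  "l1_borel N K = sigma K {U. openin (subtopology (l1.mtopology N) K) U}"

definition weight_measure :: "nat \<Rightarrow> (nat \<Rightarrow> real) set \<Rightarrow> ((nat \<Rightarrow> real) set \<Rightarrow> real) \<Rightarrow> bool" where
  "weight_measure N K \<omega> \<longleftrightarrow>
     finite_signed_measure (l1_borel N K) \<omega> \<and>
     (\<forall>a\<in>K. signed_integral (l1_borel N K) \<omega> (\<lambda>x. exp (- l1_dist N x a)) = 1)"

definition mag_domain :: "nat \<Rightarrow> (nat \<Rightarrow> real) set set" where
  "mag_domain N = {K \<in> l1.nonempty_compacts N. \<exists>\<omega>. weight_measure N K \<omega>}"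

text \<open>Meaningful on \<^term>\<open>mag_domain N\<close> only. A weight measure is unique as a function on the Borel
  sets of \<open>K\<close>; its values elsewhere are arbitrary, hence the description of the number
  \<open>\<omega> K\<close> rather than of \<open>\<omega>\<close>.\<close>

definition mag :: "nat \<Rightarrow> (nat \<Rightarrow> real) set \<Rightarrow> real" where
  "mag N K = (THE m. \<exists>\<omega>. weight_measure N K \<omega> \<and> m = \<omega> K)"

end

theory Submission
  imports Defs
begin

text \<open>Write \<open>Q\<^sub>F(u)\<close> for the energy \<open>\<Sum> u\<^sub>p u\<^sub>q exp (- d\<^sub>1(p, q))\<close>, a positive semidefinite form.
  If \<open>w\<close> is the weighting of \<open>F\<close> and \<open>\<omega>\<close> a weight measure of a set \<open>K\<close> near \<open>F\<close>, moving \<open>w\<close> to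
  nearby points of \<open>K\<close> changes its energy little, and the Cauchy-Schwarz inequality against \<open>\<omega>\<close> bounds
  \<open>mag K\<close> from below.

  For the upper bound, cut out of every coordinate axis the intervals of radius \<open>\<epsilon>\<close> around the
  coordinates of the points of \<open>F\<close>. This collapses \<open>K\<close> to a set of \<open>card F\<close> points close to \<open>F\<close>. Cutting
  out an interval of length \<open>\<delta>\<close> multiplies the energy by at most \<open>exp \<delta>\<close>, whatever the measure, so the
  push-forward \<open>u\<close> of \<open>\<omega>\<close> satisfies \<open>(mag K)\<^sup>2 = (\<Sum> u)\<^sup>2 \<le> mag F * Q\<^sub>F(u) \<le> mag F * (1 + o(1)) * mag K\<close>;
  here strict positive definiteness on \<open>F\<close> absorbs the displacement of the finitely many points.\<close>

section \<open>Energy with respect to the exponential kernel\<close>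

definition l1_kernel :: "nat \<Rightarrow> (nat \<Rightarrow> real) \<Rightarrow> (nat \<Rightarrow> real) \<Rightarrow> real" where
  "l1_kernel N x y = exp (- l1_dist N x y)"

text \<open>The points form indexed families rather than sets, so that they may coincide after a
  collapse and two families may be joined over a disjoint sum of index sets.\<close>

definition l1_pairing ::
  "nat \<Rightarrow> 'i set \<Rightarrow> ('i \<Rightarrow> nat \<Rightarrow> real) \<Rightarrow> ('i \<Rightarrow> real) \<Rightarrow>
    'j set \<Rightarrow> ('j \<Rightarrow> nat \<Rightarrow> real) \<Rightarrow> ('j \<Rightarrow> real) \<Rightarrow> real" where
  "l1_pairing N I x u J y v = (\<Sum>i\<in>I. \<Sum>j\<in>J. u i * v j * l1_kernel N (x i) (y j))"

abbreviation l1_energy :: "nat \<Rightarrow> 'i set \<Rightarrow> ('i \<Rightarrow> nat \<Rightarrow> real) \<Rightarrow> ('i \<Rightarrow> real) \<Rightarrow> real" where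
  "l1_energy N I x u \<equiv> l1_pairing N I x u I x u"

lemma l1_kernel_commute: "l1_kernel N x y = l1_kernel N y x"
  by (simp add: l1_kernel_def l1.commute)

lemma l1_kernel_nonneg: "0 \<le> l1_kernel N x y"
  by (simp add: l1_kernel_def)

lemma l1_kernel_le_1: "l1_kernel N x y \<le> 1"
  by (simp add: l1_kernel_def)

text \<open>Needed for arbitrary functions, since collapsed points may fail to vanish from index
  \<open>N\<close> on.\<close>

lemma l1_dist_triangle: "l1_dist N x z \<le> l1_dist N x y + l1_dist N y z"
proof -
  have "l1_dist N x z \<le> (\<Sum>k<N. \<bar>x k - y k\<bar> + \<bar>y k - z k\<bar>)"
    unfolding l1_dist_def by (intro sum_mono) linarith
  then show ?thesis by (simp add: l1_dist_def sum.distrib)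
qed

lemma abs_exp_minus_diff_le:
  fixes a b :: real
  assumes "0 \<le> a" "0 \<le> b"
  shows "\<bar>exp (- a) - exp (- b)\<bar> \<le> \<bar>a - b\<bar>"
proof -
  have *: "exp (- a) - exp (- b) \<le> b - a" if "0 \<le> a" "a \<le> b" for a b :: real
  proof -
    have "exp (- a) - exp (- b) = exp (- a) * (1 - exp (- (b - a)))"
      by (simp add: right_diff_distrib flip: exp_add)
    also have "\<dots> \<le> 1 * (b - a)"
    proof (rule mult_mono)
      show "1 - exp (- (b - a)) \<le> b - a"
        using exp_ge_add_one_self[of "- (b - a)"] by linarith
    qed (use that in auto)
    finally show ?thesis by simp
  qed
  show ?thesis
    using *[of a b] *[of b a] assms by (cases "a \<le> b") (auto simp: abs_if)
qed

lemma l1_kernel_diff_le: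
  "\<bar>l1_kernel N x y - l1_kernel N x' y'\<bar> \<le> l1_dist N x x' + l1_dist N y y'"
proof -
  have "\<bar>l1_kernel N x y - l1_kernel N x' y'\<bar> \<le> \<bar>l1_dist N x y - l1_dist N x' y'\<bar>"
    unfolding l1_kernel_def by (rule abs_exp_minus_diff_le) simp_all
  also have "\<dots> \<le> l1_dist N x x' + l1_dist N y y'"
    using l1_dist_triangle[of N x y x'] l1_dist_triangle[of N x' y y'] l1_dist_triangle[of N x' y' x]
      l1_dist_triangle[of N x y' y] l1.commute[of N x x'] l1.commute[of N y y'] by linarith
  finally show ?thesis .
qed

lemma l1_pairing_commute: "l1_pairing N I x u J y v = l1_pairing N J y v I x u"
  unfolding l1_pairing_def
  by (subst sum.swap) (simp add: l1_kernel_commute mult.commute)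

lemma l1_pairing_eq_left:
  "l1_pairing N I x u J y v = (\<Sum>i\<in>I. u i * (\<Sum>j\<in>J. v j * l1_kernel N (y j) (x i)))"
  unfolding l1_pairing_def by (simp add: sum_distrib_left mult.assoc l1_kernel_commute)

text \<open>Subtracting the minimal \<open>b i\<close> from all of them splits off a nonnegative multiple of the form of
  \<open>R\<close> and makes the index of the minimum disappear.\<close>

lemma psd_times_min:
  fixes R :: "'i \<Rightarrow> 'i \<Rightarrow> real"
  assumes "finite J"
    and "\<And>S v. S \<subseteq> J \<Longrightarrow> 0 \<le> (\<Sum>i\<in>S. \<Sum>j\<in>S. v i * v j * R i j)"
    and "\<And>i. i \<in> J \<Longrightarrow> 0 \<le> b i"
  shows "0 \<le> (\<Sum>i\<in>J. \<Sum>j\<in>J. v i * v j * (R i j * min (b i) (b j)))"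
  using assms
proof (induction J arbitrary: b rule: finite_psubset_induct)
  case (psubset J)
  show ?case
  proof (cases "J = {}")
    case False
    define m where "m = Min (b ` J)"
    have "m \<in> b ` J" using psubset.hyps False by (auto simp: m_def)
    then obtain i0 where i0: "i0 \<in> J" "b i0 = m" by auto
    have m: "m \<le> b i" if "i \<in> J" for i using psubset.hyps that by (auto simp: m_def)
    define c where "c i = b i - m" for i
    have "(\<Sum>i\<in>J. \<Sum>j\<in>J. v i * v j * (R i j * min (b i) (b j)))
        = (\<Sum>i\<in>J. \<Sum>j\<in>J. m * (v i * v j * R i j) + v i * v j * (R i j * min (c i) (c j)))"
    proof (intro sum.cong refl)
      fix i j
      have "min (b i) (b j) = m + min (c i) (c j)" by (auto simp: c_def min_def)
      then show "v i * v j * (R i j * min (b i) (b j)) =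
          m * (v i * v j * R i j) + v i * v j * (R i j * min (c i) (c j))"
        by (simp add: algebra_simps)
    qed
    also have "\<dots> = m * (\<Sum>i\<in>J. \<Sum>j\<in>J. v i * v j * R i j)
        + (\<Sum>i\<in>J. \<Sum>j\<in>J. v i * v j * (R i j * min (c i) (c j)))"
      by (simp add: sum.distrib sum_distrib_left)
    also have "(\<Sum>i\<in>J. \<Sum>j\<in>J. v i * v j * (R i j * min (c i) (c j)))
        = (\<Sum>i\<in>J-{i0}. \<Sum>j\<in>J-{i0}. v i * v j * (R i j * min (c i) (c j)))"
    proof -
      have "c i0 = 0" "\<And>i. i \<in> J \<Longrightarrow> 0 \<le> c i" using i0 m by (auto simp: c_def)
      then have "min (c i0) (c i) = 0" "min (c i) (c i0) = 0" if "i \<in> J" for i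
        using that by (auto simp: min_absorb1 min_absorb2)
      then show ?thesis
        using psubset.hyps i0(1) \<open>c i0 = 0\<close> by (simp add: sum.remove[of J i0])
    qed
    finally have eq: "(\<Sum>i\<in>J. \<Sum>j\<in>J. v i * v j * (R i j * min (b i) (b j)))
        = m * (\<Sum>i\<in>J. \<Sum>j\<in>J. v i * v j * R i j)
        + (\<Sum>i\<in>J-{i0}. \<Sum>j\<in>J-{i0}. v i * v j * (R i j * min (c i) (c j)))" .
    have "0 \<le> (\<Sum>i\<in>J-{i0}. \<Sum>j\<in>J-{i0}. v i * v j * (R i j * min (c i) (c j)))"
      using i0 m by (intro psubset.IH psubset.prems) (auto simp: c_def)
    moreover have "0 \<le> m * (\<Sum>i\<in>J. \<Sum>j\<in>J. v i * v j * R i j)"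
      using psubset.prems(1)[of J] psubset.prems(2)[OF i0(1)] i0 by simp
    ultimately show ?thesis using eq by linarith
  qed simp
qed

text \<open>The kernel is a product over the coordinates. In the last one,
  \<open>exp (- \<bar>a - b\<bar>)\<close> is the minimum of \<open>exp (2 * a)\<close> and
  \<open>exp (2 * b)\<close> up to the factors \<open>exp (- a)\<close> and
  \<open>exp (- b)\<close>, which the coefficients absorb. So each further coordinate is an instance
  of \<open>psd_times_min\<close>.\<close>

lemma l1_energy_nonneg: "finite J \<Longrightarrow> 0 \<le> l1_energy N J x v"
proof (induction N arbitrary: J v)
  case 0
  have "l1_energy 0 J x v = (\<Sum>i\<in>J. v i)\<^sup>2"
    by (simp add: l1_pairing_def l1_kernel_def l1_dist_def power2_eq_square sum_product)
  then show ?case by simp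
next
  case (Suc N)
  have k: "l1_kernel (Suc N) (x i) (x j) = exp (- x i N) * exp (- x j N) *
      (l1_kernel N (x i) (x j) * min (exp (2 * x i N)) (exp (2 * x j N)))" for i j
  proof -
    have "exp (- \<bar>a - b\<bar>) = exp (- a) * exp (- b) * min (exp (2 * a)) (exp (2 * b))" for a b :: real
      by (auto simp: min_def abs_if simp flip: exp_add)
    note this[of "x i N" "x j N"]
    moreover have "l1_kernel (Suc N) (x i) (x j) =
        l1_kernel N (x i) (x j) * exp (- \<bar>x i N - x j N\<bar>)"
      by (simp add: l1_kernel_def l1_dist_def flip: exp_add)
    ultimately show ?thesis by simp
  qed
  have "0 \<le> (\<Sum>i\<in>J. \<Sum>j\<in>J. (v i * exp (- x i N)) * (v j * exp (- x j N)) *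
      (l1_kernel N (x i) (x j) * min (exp (2 * x i N)) (exp (2 * x j N))))"
    using Suc.prems Suc.IH[unfolded l1_pairing_def]
    by (intro psd_times_min) (auto dest: finite_subset)
  then show ?case
    unfolding l1_pairing_def k by (simp add: mult_ac)
qed

text \<open>Semidefiniteness on the disjoint union of both families, with coefficients scaled by
  \<open>s\<close> and \<open>t\<close>, makes a binary quadratic form in \<open>s\<close> and
  \<open>t\<close> nonnegative. Suitable values of \<open>s\<close> and \<open>t\<close> give the
  inequality.\<close>

lemma l1_pairing_Cauchy_Schwarz:
  assumes I: "finite I" and J: "finite J"
  shows "(l1_pairing N I x u J y v)\<^sup>2 \<le> l1_energy N I x u * l1_energy N J y v"
proof -
  define a b c where "a = l1_energy N I x u" and "b = l1_pairing N I x u J y v"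
    and "c = l1_energy N J y v"
  have pos: "0 \<le> s\<^sup>2 * a + 2 * s * t * b + t\<^sup>2 * c" for s t
  proof -
    have "0 \<le> l1_energy N (I <+> J) (case_sum x y) (case_sum (\<lambda>i. s * u i) (\<lambda>j. t * v j))"
      using I J by (intro l1_energy_nonneg) auto
    also have "\<dots> = l1_pairing N I x (\<lambda>i. s * u i) I x (\<lambda>i. s * u i)
        + l1_pairing N I x (\<lambda>i. s * u i) J y (\<lambda>i. t * v i)
        + (l1_pairing N J y (\<lambda>i. t * v i) I x (\<lambda>i. s * u i)
        + l1_pairing N J y (\<lambda>i. t * v i) J y (\<lambda>i. t * v i))"
      using I J unfolding l1_pairing_def by (simp add: sum.Plus sum.distrib)
    also have "l1_pairing N J y (\<lambda>i. t * v i) I x (\<lambda>i. s * u i)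
        = l1_pairing N I x (\<lambda>i. s * u i) J y (\<lambda>i. t * v i)"
      by (rule l1_pairing_commute)
    also have "l1_pairing N I x (\<lambda>i. s * u i) I x (\<lambda>i. s * u i) = s\<^sup>2 * a"
      unfolding a_def l1_pairing_def by (simp add: sum_distrib_left power2_eq_square mult_ac)
    also have "l1_pairing N I x (\<lambda>i. s * u i) J y (\<lambda>i. t * v i) = s * t * b"
      unfolding b_def l1_pairing_def by (simp add: sum_distrib_left mult_ac)
    also have "l1_pairing N J y (\<lambda>i. t * v i) J y (\<lambda>i. t * v i) = t\<^sup>2 * c"
      unfolding c_def l1_pairing_def by (simp add: sum_distrib_left power2_eq_square mult_ac)
    finally show ?thesis by (simp add: algebra_simps)
  qed
  have "0 \<le> a" "0 \<le> c" using I J l1_energy_nonneg by (auto simp: a_def c_def)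
  have "b\<^sup>2 \<le> a * c"
  proof (cases "a = 0")
    case True
    have "b = 0"
    proof (rule ccontr)
      assume "b \<noteq> 0"
      \<comment> \<open>For \<open>a = 0\<close> and \<open>t = 1\<close> the form is affine in
        \<open>s\<close>; this \<open>s\<close> makes its value \<open>- c - 2\<close>.\<close>
      have "0 \<le> 2 * (- (c + 1) / b) * b + c"
        using pos[of "- (c + 1) / b" 1] True by simp
      then have "0 \<le> - 2 * (c + 1) + c" using \<open>b \<noteq> 0\<close> by simp
      then show False using \<open>0 \<le> c\<close> by simp
    qed
    then show ?thesis using \<open>0 \<le> c\<close> \<open>0 \<le> a\<close> by simp
  next
    case False
    then have "a > 0" using \<open>0 \<le> a\<close> by simp
    have "0 \<le> b\<^sup>2 * a - 2 * b * a * b + a\<^sup>2 * c" using pos[of "- b" a] by simp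
    also have "\<dots> = a * (a * c - b\<^sup>2)" by (simp add: power2_eq_square algebra_simps)
    finally show ?thesis using \<open>a > 0\<close> by (simp add: zero_le_mult_iff)
  qed
  then show ?thesis by (simp add: a_def b_def c_def)
qed

section \<open>Collapsing intervals\<close>

text \<open>\<open>L\<close> collects the indices on one side of the gap. In
  \<open>exp \<delta> * l1_energy N J x v - l1_energy N J y v\<close> the pairs across the gap
  cancel. What remains is \<open>exp \<delta> - 1\<close> times the energies of the parts of
  \<open>v\<close> on \<open>L\<close> and off \<open>L\<close>, both nonnegative.\<close>

lemma l1_energy_gap:
  assumes J: "finite J" and "0 \<le> \<delta>"
    and k: "\<And>i j. i \<in> J \<Longrightarrow> j \<in> J \<Longrightarrow> l1_kernel N (y i) (y j) =
        (if i \<in> L \<longleftrightarrow> j \<in> L then 1 else exp \<delta>) * l1_kernel N (x i) (x j)"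
  shows "l1_energy N J y v \<le> exp \<delta> * l1_energy N J x v"
proof -
  define v1 v2 where "v1 i = (if i \<in> L then v i else 0)" and "v2 i = (if i \<in> L then 0 else v i)" for i
  have "exp \<delta> * l1_energy N J x v - l1_energy N J y v
      = (\<Sum>i\<in>J. \<Sum>j\<in>J. exp \<delta> * (v i * v j * l1_kernel N (x i) (x j)) - v i * v j * l1_kernel N (y i) (y j))"
    by (simp add: l1_pairing_def sum_distrib_left sum_subtractf)
  also have "\<dots> = (\<Sum>i\<in>J. \<Sum>j\<in>J. (exp \<delta> - 1) * (v1 i * v1 j * l1_kernel N (x i) (x j)) +
      (exp \<delta> - 1) * (v2 i * v2 j * l1_kernel N (x i) (x j)))"
    by (intro sum.cong refl) (auto simp: k v1_def v2_def algebra_simps)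
  also have "\<dots> = (exp \<delta> - 1) * (l1_energy N J x v1 + l1_energy N J x v2)"
    by (simp add: l1_pairing_def sum.distrib sum_distrib_left ring_distribs)
  also have "\<dots> \<ge> 0"
    using J \<open>0 \<le> \<delta>\<close> by (intro mult_nonneg_nonneg add_nonneg_nonneg l1_energy_nonneg) auto
  finally show ?thesis by simp
qed

lemma l1_kernel_fun_upd:
  assumes "k < N"
  shows "l1_kernel N (x(k := a)) (y(k := b)) = exp (\<bar>x k - y k\<bar> - \<bar>a - b\<bar>) * l1_kernel N x y"
proof -
  have "(\<Sum>j\<in>{..<N} - {k}. \<bar>(x(k := a)) j - (y(k := b)) j\<bar>) = (\<Sum>j\<in>{..<N} - {k}. \<bar>x j - y j\<bar>)"
    by (intro sum.cong) auto
  then have "l1_dist N (x(k := a)) (y(k := b)) = l1_dist N x y - \<bar>x k - y k\<bar> + \<bar>a - b\<bar>"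
    using assms by (simp add: l1_dist_def sum.remove[of "{..<N}" k])
  then show ?thesis by (simp add: l1_kernel_def flip: exp_add)
qed

definition collapse :: "real \<Rightarrow> real \<Rightarrow> real \<Rightarrow> real" where
  "collapse s \<delta> t = (if t \<le> s then t else max s (t - \<delta>))"

text \<open>Removing a gap between the points multiplies the kernel across the gap by \<open>exp \<delta>\<close> and leaves it
  unchanged on either side. An interval containing points is removed gap by gap.\<close>

lemma l1_energy_collapse:
  assumes "finite J" "0 \<le> \<delta>" "k < N"
  shows "l1_energy N J (\<lambda>i. (x i)(k := collapse s \<delta> (x i k))) v \<le> exp \<delta> * l1_energy N J x v"
  using assms(2)
proof (induction "card {i \<in> J. s < x i k \<and> x i k < s + \<delta>}" arbitrary: s \<delta> x rule: less_induct)
  case less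
  show ?case
  proof (cases "{i \<in> J. s < x i k \<and> x i k < s + \<delta>} = {}")
    case True
    show ?thesis
    proof (rule l1_energy_gap[where L = "{i. x i k \<le> s}"])
      fix i j assume ij: "i \<in> J" "j \<in> J"
      have c: "x i k \<le> s \<or> s + \<delta> \<le> x i k" "x j k \<le> s \<or> s + \<delta> \<le> x j k"
        using True ij by force+
      show "l1_kernel N ((x i)(k := collapse s \<delta> (x i k))) ((x j)(k := collapse s \<delta> (x j k))) =
        (if i \<in> {i. x i k \<le> s} \<longleftrightarrow> j \<in> {i. x i k \<le> s} then 1 else exp \<delta>) * l1_kernel N (x i) (x j)"
        using c less.prems by (auto simp: l1_kernel_fun_upd[OF assms(3)] collapse_def max_def abs_if)
    qed (use less.prems assms in auto)
  next
    case False
    then obtain i0 where i0: "i0 \<in> J" "s < x i0 k" "x i0 k < s + \<delta>" by auto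
    \<comment> \<open>The interval is cut at the coordinate of one of its points: the part to the
      right of \<open>m\<close> is contracted first, then the part from \<open>s\<close> to
      \<open>m\<close>. The point \<open>i0\<close> is interior to neither part and no new point
      enters, so both counts drop.\<close>
    define m where "m = x i0 k"
    define y where "y i = (x i)(k := collapse m (s + \<delta> - m) (x i k))" for i
    have m: "s < m" "m < s + \<delta>" using i0 by (auto simp: m_def)
    have "collapse s \<delta> t = collapse s (m - s) (collapse m (s + \<delta> - m) t)" for t
      using m by (auto simp: collapse_def max_def)
    then have "l1_energy N J (\<lambda>i. (x i)(k := collapse s \<delta> (x i k))) v
        = l1_energy N J (\<lambda>i. (y i)(k := collapse s (m - s) (y i k))) v"
      by (simp add: y_def)
    also have "\<dots> \<le> exp (m - s) * l1_energy N J y v"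
    proof (rule less.hyps)
      have "{i \<in> J. s < y i k \<and> y i k < s + (m - s)} \<subset> {i \<in> J. s < x i k \<and> x i k < s + \<delta>}"
        using i0 m by (auto simp: y_def collapse_def m_def split: if_splits)
      then show "card {i \<in> J. s < y i k \<and> y i k < s + (m - s)} < card {i \<in> J. s < x i k \<and> x i k < s + \<delta>}"
        using assms(1) by (intro psubset_card_mono) auto
    qed (use m in simp)
    also have "\<dots> \<le> exp (m - s) * (exp (s + \<delta> - m) * l1_energy N J x v)"
      unfolding y_def
    proof (intro mult_left_mono less.hyps)
      have "{i \<in> J. m < x i k \<and> x i k < m + (s + \<delta> - m)} \<subset> {i \<in> J. s < x i k \<and> x i k < s + \<delta>}"
        using i0 m by (auto simp: m_def)
      then show "card {i \<in> J. m < x i k \<and> x i k < m + (s + \<delta> - m)}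
          < card {i \<in> J. s < x i k \<and> x i k < s + \<delta>}"
        using assms(1) by (intro psubset_card_mono) auto
    qed (use m in simp_all)
    also have "\<dots> = exp \<delta> * l1_energy N J x v" by (simp flip: exp_add mult.assoc)
    finally show ?thesis .
  qed
qed

text \<open>The intervals of radius \<epsilon> around the points of \<open>T\<close> are contracted
  one after another from right to left. Each contraction costs a factor
  \<open>exp (2 * \<epsilon>)\<close> and moves points to the left by at most
  \<open>2 * \<epsilon>\<close>. It fixes everything to the left of its interval, so the next
  interval is still in its original place; the clause \<open>g s = s\<close> carries this through
  the induction.\<close>

lemma ex_collapse_near_finite:
  fixes T :: "real set"
  assumes "finite T" "0 \<le> \<epsilon>"
    and "\<And>t t'. t \<in> T \<Longrightarrow> t' \<in> T \<Longrightarrow> t < t' \<Longrightarrow> t + \<epsilon> \<le> t' - \<epsilon>"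
  shows "\<exists>g. (\<forall>t. t - 2 * \<epsilon> * card T \<le> g t \<and> g t \<le> t) \<and>
    (\<forall>t\<in>T. \<forall>s\<in>{t-\<epsilon>..t+\<epsilon>}. \<forall>s'\<in>{t-\<epsilon>..t+\<epsilon>}. g s = g s') \<and>
    (\<forall>s. (\<forall>t\<in>T. s \<le> t - \<epsilon>) \<longrightarrow> g s = s) \<and>
    (\<forall>N k (J :: 'i set) x v. k < N \<longrightarrow> finite J \<longrightarrow>
       l1_energy N J (\<lambda>i. (x i)(k := g (x i k))) v \<le> exp (2 * \<epsilon> * card T) * l1_energy N J x v)"
  using assms(1,3)
proof (induction T rule: finite_linorder_min_induct)
  case empty
  show ?case by (rule exI[of _ "\<lambda>t. t"]) auto
next
  case (insert b A)
  obtain g where g: "\<And>t. t - 2 * \<epsilon> * card A \<le> g t" "\<And>t. g t \<le> t"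
      "\<And>t s s'. t \<in> A \<Longrightarrow> s \<in> {t-\<epsilon>..t+\<epsilon>} \<Longrightarrow> s' \<in> {t-\<epsilon>..t+\<epsilon>} \<Longrightarrow> g s = g s'"
      "\<And>s. (\<And>t. t \<in> A \<Longrightarrow> s \<le> t - \<epsilon>) \<Longrightarrow> g s = s"
      "\<And>N k J x v. k < N \<Longrightarrow> finite (J :: 'i set) \<Longrightarrow>
         l1_energy N J (\<lambda>i. (x i)(k := g (x i k))) v \<le> exp (2 * \<epsilon> * card A) * l1_energy N J x v"
    using insert.IH insert.prems by (smt (verit, ccfv_threshold) insertI2)
  define f where "f t = collapse (b - \<epsilon>) (2 * \<epsilon>) (g t)" for t
  have card: "2 * \<epsilon> * card (insert b A) = 2 * \<epsilon> * card A + 2 * \<epsilon>"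
    using insert.hyps by (subst card_insert_disjoint) (auto simp: algebra_simps)
  have "t - 2 * \<epsilon> * card (insert b A) \<le> f t" "f t \<le> t" for t
    using g(1,2)[of t] assms(2) unfolding card f_def collapse_def by (auto simp: max_def)
  moreover have "f s = f s'"
    if "t \<in> insert b A" "s \<in> {t-\<epsilon>..t+\<epsilon>}" "s' \<in> {t-\<epsilon>..t+\<epsilon>}" for t s s'
  proof (cases "t \<in> A")
    case True
    then show ?thesis using g(3)[OF True that(2,3)] by (simp add: f_def)
  next
    case False
    then have t: "t = b" using that by simp
    have "f s = b - \<epsilon>" if s: "s \<in> {b-\<epsilon>..b+\<epsilon>}" for s
    proof -
      have "g s = s"
      proof (rule g(4))
        fix a assume "a \<in> A"
        then have "b + \<epsilon> \<le> a - \<epsilon>" using insert.prems[of b a] insert.hyps by auto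
        then show "s \<le> a - \<epsilon>" using s by auto
      qed
      then show ?thesis using s by (auto simp: f_def collapse_def)
    qed
    then show ?thesis using that t by simp
  qed
  moreover have "f s = s" if "\<forall>t\<in>insert b A. s \<le> t - \<epsilon>" for s
    using that g(4)[of s] by (auto simp: f_def collapse_def)
  moreover have "l1_energy N J (\<lambda>i. (x i)(k := f (x i k))) v
      \<le> exp (2 * \<epsilon> * card (insert b A)) * l1_energy N J x v"
    if "k < N" "finite J" for N k and J :: "'i set" and x v
  proof -
    have "l1_energy N J (\<lambda>i. (x i)(k := f (x i k))) v
        \<le> exp (2 * \<epsilon>) * l1_energy N J (\<lambda>i. (x i)(k := g (x i k))) v"
      using l1_energy_collapse[of J "2 * \<epsilon>" k N "\<lambda>i. (x i)(k := g (x i k))" "b - \<epsilon>" v] that assms(2)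
      by (simp add: f_def)
    also have "\<dots> \<le> exp (2 * \<epsilon>) * (exp (2 * \<epsilon> * card A) * l1_energy N J x v)"
      by (intro mult_left_mono g(5) that) simp
    also have "\<dots> = exp (2 * \<epsilon> * card (insert b A)) * l1_energy N J x v"
      unfolding card by (simp add: exp_add)
    finally show ?thesis .
  qed
  ultimately show ?case by blast
qed

section \<open>Collapsing in all coordinates\<close>

lemma l1_kernel_cong:
  "(\<And>k. k < N \<Longrightarrow> x k = x' k) \<Longrightarrow> (\<And>k. k < N \<Longrightarrow> y k = y' k) \<Longrightarrow> l1_kernel N x y = l1_kernel N x' y'"
  by (simp add: l1_kernel_def l1_dist_def)

lemma l1_energy_coordinatewise:
  assumes "0 \<le> C"
    and "\<And>k x v. k < N \<Longrightarrow> l1_energy N J (\<lambda>i. (x i)(k := g k (x i k))) v \<le> C * l1_energy N J x v"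
  shows "l1_energy N J (\<lambda>i k. g k (x i k)) v \<le> C ^ N * l1_energy N J x v"
proof -
  define y where "y m i k = (if k < m then g k (x i k) else x i k)" for m i k
  have "l1_energy N J (y m) v \<le> C ^ m * l1_energy N J x v" if "m \<le> N" for m
    using that
  proof (induction m)
    case 0
    then show ?case by (simp add: y_def)
  next
    case (Suc m)
    have "y (Suc m) = (\<lambda>i. (y m i)(m := g m (y m i m)))"
      by (auto simp: y_def fun_eq_iff less_Suc_eq)
    then have "l1_energy N J (y (Suc m)) v \<le> C * l1_energy N J (y m) v"
      using assms(2)[of m "y m" v] Suc.prems by simp
    also have "\<dots> \<le> C * (C ^ m * l1_energy N J x v)"
      using Suc assms(1) by (intro mult_left_mono) auto
    finally show ?case by (simp add: mult.assoc)
  qed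
  then have "l1_energy N J (y N) v \<le> C ^ N * l1_energy N J x v" by simp
  \<comment> \<open>\<open>y N\<close> keeps the original coordinates from index \<open>N\<close>
    on, where the kernel does not look.\<close>
  moreover have "l1_kernel N (y N i) (y N j) = l1_kernel N (\<lambda>k. g k (x i k)) (\<lambda>k. g k (x j k))" for i j
    by (rule l1_kernel_cong) (simp_all add: y_def)
  ultimately show ?thesis by (simp add: l1_pairing_def)
qed

text \<open>Grouping both arguments of the form along the fibres of \<pi> turns a collapsed family
  into the push-forward of its coefficients to \<open>F\<close>.\<close>

lemma l1_energy_comp:
  assumes "finite J" "finite F" "\<pi> ` J \<subseteq> F"
  shows "l1_energy N J (\<lambda>i. y (\<pi> i)) v
    = l1_energy N F y (\<lambda>p. \<Sum>i\<in>{i \<in> J. \<pi> i = p}. v i)" (is "_ = l1_energy N F y ?u")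
proof -
  have group: "(\<Sum>i\<in>J. v i * h (\<pi> i)) = (\<Sum>p\<in>F. ?u p * h p)" for h
    by (subst sum.group[OF assms, symmetric]) (auto simp: sum_distrib_right intro!: sum.cong)
  show ?thesis
    unfolding l1_pairing_eq_left group[where h = "\<lambda>p. l1_kernel N (y p) z" for z]
    by (rule group)
qed

text \<open>Each coordinate gets its own map from \<open>ex_collapse_near_finite\<close>, for the
  set of \<open>k\<close>-th coordinates of \<open>F\<close>; the gap hypothesis keeps the intervals
  from overlapping. As \<open>x i\<close> lies within \<epsilon> of \<open>\<pi> i\<close> in every
  coordinate, both collapse to the same point. Displacements add up and energy factors multiply over
  the \<open>N\<close> coordinates.\<close>

lemma l1_energy_ge_near_finite:
  fixes J :: "'i set"
  assumes F: "finite F" and J: "finite J" and \<epsilon>: "0 \<le> \<epsilon>"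
    and gap: "\<And>p q k. p \<in> F \<Longrightarrow> q \<in> F \<Longrightarrow> k < N \<Longrightarrow> p k \<noteq> q k \<Longrightarrow> 2 * \<epsilon> \<le> \<bar>p k - q k\<bar>"
    and \<pi>: "\<And>i. i \<in> J \<Longrightarrow> \<pi> i \<in> F" "\<And>i. i \<in> J \<Longrightarrow> l1_dist N (x i) (\<pi> i) \<le> \<epsilon>"
  shows "\<exists>y. (\<forall>p\<in>F. l1_dist N (y p) p \<le> 2 * \<epsilon> * card F * N) \<and>
    l1_energy N F y (\<lambda>p. \<Sum>i\<in>{i \<in> J. \<pi> i = p}. v i) \<le> exp (2 * \<epsilon> * card F * N) * l1_energy N J x v"
proof -
  let ?T = "\<lambda>k. (\<lambda>p. p k) ` F"
  define P where "P k g \<longleftrightarrow> (\<forall>t. t - 2 * \<epsilon> * card (?T k) \<le> g t \<and> g t \<le> t) \<and>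
    (\<forall>t\<in>?T k. \<forall>s\<in>{t-\<epsilon>..t+\<epsilon>}. \<forall>s'\<in>{t-\<epsilon>..t+\<epsilon>}. g s = g s') \<and>
    (\<forall>s. (\<forall>t\<in>?T k. s \<le> t - \<epsilon>) \<longrightarrow> g s = s) \<and>
    (\<forall>N k' (J :: 'i set) x v. k' < N \<longrightarrow> finite J \<longrightarrow>
       l1_energy N J (\<lambda>i. (x i)(k' := g (x i k'))) v \<le> exp (2 * \<epsilon> * card (?T k)) * l1_energy N J x v)"
    for k g
  have "\<exists>g. P k g" if "k < N" for k
    unfolding P_def
  proof (rule ex_collapse_near_finite)
    fix t t' assume tt: "t \<in> ?T k" "t' \<in> ?T k" "t < t'"
    then obtain p q where "p \<in> F" "q \<in> F" "t = p k" "t' = q k" by auto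
    then show "t + \<epsilon> \<le> t' - \<epsilon>" using gap[of p q k] tt(3) that by simp
  qed (use F \<epsilon> in auto)
  then obtain g where "\<And>k. k < N \<Longrightarrow> P k (g k)" by metis
  then have g: "t - 2 * \<epsilon> * card (?T k) \<le> g k t" "g k t \<le> t"
      "t \<in> ?T k \<Longrightarrow> s \<in> {t-\<epsilon>..t+\<epsilon>} \<Longrightarrow> s' \<in> {t-\<epsilon>..t+\<epsilon>} \<Longrightarrow> g k s = g k s'"
      "k' < N' \<Longrightarrow> finite J' \<Longrightarrow>
       l1_energy N' J' (\<lambda>i. (x' i)(k' := g k (x' i k'))) v' \<le> exp (2 * \<epsilon> * card (?T k)) * l1_energy N' J' x' v'"
    if "k < N" for k t s s' k' N' x' v' and J' :: "'i set"
    using that unfolding P_def by blast+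
  have card: "2 * \<epsilon> * card (?T k) \<le> 2 * \<epsilon> * card F" for k
    using \<epsilon> F by (intro mult_left_mono) (auto intro: card_image_le)
  define y where "y p k = g k (p k)" for p k
  have "l1_dist N (y p) p \<le> 2 * \<epsilon> * card F * N" if "p \<in> F" for p
  proof -
    have "\<bar>y p k - p k\<bar> \<le> 2 * \<epsilon> * card F" if "k < N" for k
      using g(1,2)[OF that, of "p k"] card[of k] by (simp add: y_def)
    then have "l1_dist N (y p) p \<le> (\<Sum>k<N. 2 * \<epsilon> * card F)"
      unfolding l1_dist_def by (intro sum_mono) auto
    then show ?thesis by (simp add: mult.commute)
  qed
  moreover have "l1_energy N F y (\<lambda>p. \<Sum>i\<in>{i \<in> J. \<pi> i = p}. v i)
      \<le> exp (2 * \<epsilon> * card F * N) * l1_energy N J x v"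
  proof -
    have eq: "y (x i) k = y (\<pi> i) k" if "i \<in> J" "k < N" for i k
    proof -
      have "\<bar>x i k - \<pi> i k\<bar> \<le> l1_dist N (x i) (\<pi> i)"
        unfolding l1_dist_def using that by (intro member_le_sum) auto
      then have "\<bar>x i k - \<pi> i k\<bar> \<le> \<epsilon>" using \<pi>(2)[OF that(1)] by linarith
      then show ?thesis
        using that \<pi>(1) \<epsilon> unfolding y_def by (intro g(3)[of k "\<pi> i k"]) auto
    qed
    have "l1_energy N F y (\<lambda>p. \<Sum>i\<in>{i \<in> J. \<pi> i = p}. v i) = l1_energy N J (\<lambda>i. y (\<pi> i)) v"
      using F J \<pi> by (subst l1_energy_comp[of J F]) auto
    also have "\<dots> = l1_energy N J (\<lambda>i. y (x i)) v"
      unfolding l1_pairing_def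
      by (intro sum.cong refl arg_cong[where f = "\<lambda>t. _ * t"] l1_kernel_cong) (simp_all add: eq)
    also have "\<dots> \<le> exp (2 * \<epsilon> * card F) ^ N * l1_energy N J x v"
      unfolding y_def
    proof (rule l1_energy_coordinatewise)
      fix k x and v :: "'i \<Rightarrow> real" assume "k < N"
      then have "l1_energy N J (\<lambda>i. (x i)(k := g k (x i k))) v
          \<le> exp (2 * \<epsilon> * card (?T k)) * l1_energy N J x v"
        using J by (intro g(4))
      also have "\<dots> \<le> exp (2 * \<epsilon> * card F) * l1_energy N J x v"
        using card J by (intro mult_right_mono l1_energy_nonneg) auto
      finally show "l1_energy N J (\<lambda>i. (x i)(k := g k (x i k))) v
          \<le> exp (2 * \<epsilon> * card F) * l1_energy N J x v" .
    qed simp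
    also have "exp (2 * \<epsilon> * card F) ^ N = exp (2 * \<epsilon> * card F * N)"
      by (simp add: exp_of_nat_mult[symmetric] mult.commute)
    finally show ?thesis .
  qed
  ultimately show ?thesis by blast
qed

section \<open>Finite sets\<close>

lemma l1_kernel_eq_prod: "l1_kernel N x y = (\<Prod>k<N. exp (- \<bar>x k - y k\<bar>))"
  by (simp add: l1_kernel_def l1_dist_def exp_sum flip: sum_negf)

text \<open>The function \<open>exp (-\<bar>t - h\<bar>) + exp (-\<bar>t + h\<bar>) - 2 * cosh h * exp (-\<bar>t\<bar>)\<close> vanishes
  outside \<open>]-h, h[\<close>; products of such functions over the coordinates separate the points.\<close>

lemma ex_l1_kernel_bump:
  assumes h: "0 < h"
  shows "\<exists>(I :: (nat \<Rightarrow> real) set) y c. finite I \<and>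
    (\<forall>x. (\<forall>k<N. x k = p k \<or> h \<le> \<bar>x k - p k\<bar>) \<longrightarrow>
      (\<Sum>i\<in>I. c i * l1_kernel N (y i) x) = (if \<forall>k<N. x k = p k then 1 else 0))"
proof -
  define S :: "real set" where "S = {-1, 0, 1}"
  \<comment> \<open>The divisor is the value
    \<open>2 * exp (- h) - 2 * cosh h = - 2 * sinh h\<close> of the one-dimensional bump at its
    centre, which normalises that value to 1.\<close>
  define \<gamma> where "\<gamma> s = (if s = 0 then - 2 * cosh h else 1) / (- 2 * sinh h)" for s :: real
  \<comment> \<open>An index chooses a shift by \<open>-h\<close>, 0 or \<open>h\<close> in every
    coordinate; these are the terms of the product of \<open>N\<close> bumps when multiplied
    out.\<close>
  define I where "I = PiE {..<N} (\<lambda>_. S)"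
  define y where "y f k = p k + h * f k" for f k
  define c where "c f = (\<Prod>k<N. \<gamma> (f k))" for f
  have "sinh h \<noteq> 0" using h by simp
  have bump: "(\<Sum>s\<in>S. \<gamma> s * exp (- \<bar>a + h * s - t\<bar>)) = (if t = a then 1 else 0)"
    if "t = a \<or> h \<le> \<bar>t - a\<bar>" for a t
  proof -
    have eq: "(\<Sum>s\<in>S. \<gamma> s * exp (- \<bar>a + h * s - t\<bar>)) =
        (exp (- \<bar>a - h - t\<bar>) - 2 * cosh h * exp (- \<bar>a - t\<bar>) + exp (- \<bar>a + h - t\<bar>)) / (- 2 * sinh h)"
      by (simp add: S_def \<gamma>_def add_divide_distrib diff_divide_distrib)
    have "t = a \<or> t \<ge> a + h \<or> t \<le> a - h" using that by linarith
    then consider "t = a" | "t \<ge> a + h" | "t \<le> a - h" by blast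
    then show ?thesis
    proof cases
      case 1
      then show ?thesis
        using \<open>sinh h \<noteq> 0\<close> h unfolding eq by (simp add: cosh_def sinh_def field_simps)
    next
      case 2
      then have "exp (- \<bar>a - h - t\<bar>) = exp (a - t) * exp (- h)" "exp (- \<bar>a - t\<bar>) = exp (a - t)"
        "exp (- \<bar>a + h - t\<bar>) = exp (a - t) * exp h" using h by (simp_all flip: exp_add)
      then show ?thesis using 2 h unfolding eq by (simp add: cosh_def algebra_simps)
    next
      case 3
      then have "exp (- \<bar>a - h - t\<bar>) = exp (t - a) * exp h" "exp (- \<bar>a - t\<bar>) = exp (t - a)"
        "exp (- \<bar>a + h - t\<bar>) = exp (t - a) * exp (- h)" using h by (simp_all flip: exp_add)
      then show ?thesis using 3 h unfolding eq by (simp add: cosh_def algebra_simps)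
    qed
  qed
  have "(\<Sum>f\<in>I. c f * l1_kernel N (y f) x) = (if \<forall>k<N. x k = p k then 1 else 0)"
    if x: "\<forall>k<N. x k = p k \<or> h \<le> \<bar>x k - p k\<bar>" for x
  proof -
    have "(\<Sum>f\<in>I. c f * l1_kernel N (y f) x)
        = (\<Sum>f\<in>I. \<Prod>k<N. \<gamma> (f k) * exp (- \<bar>p k + h * f k - x k\<bar>))"
      by (simp add: c_def y_def l1_kernel_eq_prod prod.distrib)
    also have "\<dots> = (\<Prod>k<N. \<Sum>s\<in>S. \<gamma> s * exp (- \<bar>p k + h * s - x k\<bar>))"
      unfolding I_def by (rule prod_sum_PiE[symmetric]) (auto simp: S_def)
    also have "\<dots> = (\<Prod>k<N. if x k = p k then 1 else 0)"
      using x by (intro prod.cong refl bump) auto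
    also have "\<dots> = (if \<forall>k<N. x k = p k then 1 else 0)"
      by (auto simp: prod_zero_iff intro!: prod.neutral)
    finally show ?thesis .
  qed
  moreover have "finite I" by (auto simp: I_def S_def intro!: finite_PiE)
  ultimately show ?thesis by blast
qed

section \<open>Strict positive definiteness on a finite set\<close>

lemma ex_coordinate_gap:
  fixes F :: "(nat \<Rightarrow> real) set"
  assumes "finite F"
  shows "\<exists>h>0. \<forall>p\<in>F. \<forall>q\<in>F. \<forall>k<N. p k \<noteq> q k \<longrightarrow> h \<le> \<bar>p k - q k\<bar>"
proof -
  define D where "D = (\<lambda>(p, q, k). \<bar>p k - q k\<bar>) ` (F \<times> F \<times> {..<N}) - {0}"
  \<comment> \<open>The element 1 keeps the minimum defined when no two points differ in any
    coordinate below \<open>N\<close>.\<close>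
  have D: "finite (insert 1 D)" using assms by (auto simp: D_def)
  have "0 < Min (insert 1 D)" by (subst Min_gr_iff[OF D]) (auto simp: D_def)
  moreover have "Min (insert 1 D) \<le> \<bar>p k - q k\<bar>" if "p \<in> F" "q \<in> F" "k < N" "p k \<noteq> q k" for p q k
    using that D by (intro Min_le) (force simp: D_def)+
  ultimately show ?thesis by blast
qed

text \<open>A combination of kernels equal to 1 at \<open>p\<close> and to 0 at the other points of
  \<open>F\<close> pairs with \<open>u\<close> to \<open>u p\<close>. By Cauchy-Schwarz,
  \<open>A\<close> can be the energy of that combination.\<close>

lemma square_coefficient_le_l1_energy:
  assumes F: "finite F" "F \<subseteq> l1_space N" and p: "p \<in> F"
  shows "\<exists>A\<ge>0. \<forall>u. (u p)\<^sup>2 \<le> A * l1_energy N F (\<lambda>q. q) u"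
proof -
  obtain h where h: "0 < h" "\<And>q k. q \<in> F \<Longrightarrow> k < N \<Longrightarrow> q k \<noteq> p k \<Longrightarrow> h \<le> \<bar>q k - p k\<bar>"
    using ex_coordinate_gap[OF F(1), of N] p by blast
  obtain I :: "(nat \<Rightarrow> real) set" and y c where I: "finite I"
    "\<And>x. (\<forall>k<N. x k = p k \<or> h \<le> \<bar>x k - p k\<bar>) \<Longrightarrow>
      (\<Sum>i\<in>I. c i * l1_kernel N (y i) x) = (if \<forall>k<N. x k = p k then 1 else 0)"
    using ex_l1_kernel_bump[OF h(1), of N p] by blast
  have eq: "(\<Sum>i\<in>I. c i * l1_kernel N (y i) q) = (if q = p then 1 else 0)" if q: "q \<in> F" for q
  proof -
    have "(\<forall>k<N. q k = p k) \<longleftrightarrow> q = p"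
      using F(2) q p by (auto simp: l1_space_def fun_eq_iff subset_eq) (metis linorder_not_less)
    moreover have "\<forall>k<N. q k = p k \<or> h \<le> \<bar>q k - p k\<bar>" using h(2)[OF q] by blast
    ultimately show ?thesis using I(2)[of q] by simp
  qed
  have "(u p)\<^sup>2 \<le> l1_energy N I y c * l1_energy N F (\<lambda>q. q) u" for u
  proof -
    have "l1_pairing N I y c F (\<lambda>q. q) u = (\<Sum>q\<in>F. u q * (if q = p then 1 else 0))"
      by (subst l1_pairing_commute, subst l1_pairing_eq_left) (simp add: eq)
    also have "\<dots> = (\<Sum>q\<in>F. if q = p then u q else 0)" by (intro sum.cong) auto
    also have "\<dots> = u p" using F(1) p by simp
    finally show ?thesis using l1_pairing_Cauchy_Schwarz[OF I(1) F(1), of N y c "\<lambda>q. q" u] by simp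
  qed
  then show ?thesis
    using l1_energy_nonneg[OF I(1), of N y c] by (intro exI[of _ "l1_energy N I y c"]) simp
qed

text \<open>The quantitative form of strict positive definiteness that lets the energy of
  \<open>u\<close> absorb the error in \<open>l1_energy_perturb\<close>.\<close>

lemma square_sum_abs_le_l1_energy:
  assumes F: "finite F" "F \<subseteq> l1_space N"
  shows "\<exists>A\<ge>0. \<forall>u. (\<Sum>p\<in>F. \<bar>u p\<bar>)\<^sup>2 \<le> A * l1_energy N F (\<lambda>q. q) u"
proof -
  have "\<forall>p\<in>F. \<exists>A\<ge>0. \<forall>u. (u p)\<^sup>2 \<le> A * l1_energy N F (\<lambda>q. q) u"
    using square_coefficient_le_l1_energy[OF F] by blast
  from bchoice[OF this] obtain A
    where A: "\<And>p u. p \<in> F \<Longrightarrow> (u p)\<^sup>2 \<le> A p * l1_energy N F (\<lambda>q. q) u" by blast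
  have "(\<Sum>p\<in>F. \<bar>u p\<bar>)\<^sup>2 \<le> (\<Sum>p\<in>F. sqrt (A p))\<^sup>2 * l1_energy N F (\<lambda>q. q) u" for u
  proof -
    let ?E = "l1_energy N F (\<lambda>q. q) u"
    have "\<bar>u p\<bar> \<le> sqrt (A p) * sqrt ?E" if "p \<in> F" for p
      using real_sqrt_le_mono[OF A[OF that, of u]] by (simp add: real_sqrt_mult)
    then have "(\<Sum>p\<in>F. \<bar>u p\<bar>) \<le> (\<Sum>p\<in>F. sqrt (A p)) * sqrt ?E"
      by (simp add: sum_distrib_right sum_mono)
    then have "(\<Sum>p\<in>F. \<bar>u p\<bar>)\<^sup>2 \<le> ((\<Sum>p\<in>F. sqrt (A p)) * sqrt ?E)\<^sup>2"
      by (intro power_mono sum_nonneg) auto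
    then show ?thesis using l1_energy_nonneg[OF F(1), of N "\<lambda>q. q" u] by (simp add: power_mult_distrib)
  qed
  then show ?thesis by (intro exI[of _ "(\<Sum>p\<in>F. sqrt (A p))\<^sup>2"]) auto
qed

text \<open>Elimination, one point at a time. Solving on \<open>F\<close> for the column of the new
  point \<open>a\<close> gives a vector \<open>e\<close> with \<open>e a = 1\<close> whose potential
  vanishes on \<open>F\<close>. If it also vanished at \<open>a\<close>, the energy of
  \<open>e\<close> would be 0, against \<open>square_coefficient_le_l1_energy\<close>. So a multiple
  of \<open>e\<close> corrects the equation at \<open>a\<close> without disturbing the
  others.\<close>

lemma ex_l1_kernel_solution:
  assumes "finite F" "F \<subseteq> l1_space N"
  shows "\<exists>w. \<forall>p\<in>F. (\<Sum>q\<in>F. w q * l1_kernel N q p) = b p"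
  using assms
proof (induction F arbitrary: b rule: finite_induct)
  case (insert a F)
  let ?Z = "\<lambda>w p. \<Sum>q\<in>insert a F. w q * l1_kernel N q p"
  obtain w where w: "\<And>p. p \<in> F \<Longrightarrow> (\<Sum>q\<in>F. w q * l1_kernel N q p) = b p"
    using insert.IH[of b] insert.prems by auto
  obtain z where z: "\<And>p. p \<in> F \<Longrightarrow> (\<Sum>q\<in>F. z q * l1_kernel N q p) = l1_kernel N a p"
    using insert.IH[of "\<lambda>p. l1_kernel N a p"] insert.prems by auto
  define e where "e = (\<lambda>q. - z q)(a := 1)"
  have Ze: "?Z e p = 0" if "p \<in> F" for p
  proof -
    have "(\<Sum>q\<in>F. e q * l1_kernel N q p) = (\<Sum>q\<in>F. - (z q * l1_kernel N q p))"
      using insert.hyps by (intro sum.cong) (auto simp: e_def)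
    then show ?thesis using insert.hyps that by (simp add: z e_def sum_negf)
  qed
  have "?Z e a \<noteq> 0"
  proof
    assume "?Z e a = 0"
    then have "l1_energy N (insert a F) (\<lambda>q. q) e = 0"
      unfolding l1_pairing_eq_left using Ze by (intro sum.neutral) auto
    moreover have "\<exists>A\<ge>0. \<forall>u. (u a)\<^sup>2 \<le> A * l1_energy N (insert a F) (\<lambda>q. q) u"
      using insert.hyps insert.prems by (intro square_coefficient_le_l1_energy) auto
    then obtain A where "(e a)\<^sup>2 \<le> A * l1_energy N (insert a F) (\<lambda>q. q) e" by blast
    ultimately show False by (simp add: e_def)
  qed
  define w' where "w' = w(a := 0)"
  define t where "t = (b a - ?Z w' a) / ?Z e a"
  have "?Z (\<lambda>q. w' q + t * e q) p = b p" if p: "p \<in> insert a F" for p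
  proof -
    have "?Z (\<lambda>q. w' q + t * e q) p = ?Z w' p + t * ?Z e p"
      unfolding sum_distrib_left sum.distrib[symmetric] by (intro sum.cong refl) algebra
    also have "\<dots> = b p"
    proof (cases "p = a")
      case True
      have "t * ?Z e a = b a - ?Z w' a" using \<open>?Z e a \<noteq> 0\<close> unfolding t_def by simp
      then show ?thesis unfolding True by linarith
    next
      case False
      then have "p \<in> F" using p by simp
      have "?Z w' p = (\<Sum>q\<in>F. w q * l1_kernel N q p)"
        using insert.hyps by (auto simp: w'_def intro!: sum.cong)
      then show ?thesis using w[OF \<open>p \<in> F\<close>] Ze[OF \<open>p \<in> F\<close>] by simp
    qed
    finally show ?thesis .
  qed
  then show ?case by (intro exI[of _ "\<lambda>q. w' q + t * e q"]) blast
qed simp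

section \<open>The weighting of a finite set\<close>

locale finite_l1_weighting =
  fixes N :: nat and F :: "(nat \<Rightarrow> real) set" and w :: "(nat \<Rightarrow> real) \<Rightarrow> real"
  assumes finite: "finite F" and nonempty: "F \<noteq> {}" and l1_space: "F \<subseteq> l1_space N"
    and weighting: "\<And>p. p \<in> F \<Longrightarrow> (\<Sum>q\<in>F. w q * l1_kernel N q p) = 1"
begin

text \<open>This turns out to be the magnitude of \<open>F\<close>, by \<open>mag_eq\<close> and the
  point masses in \<open>weight_measure\<close>.\<close>

definition M where "M = (\<Sum>p\<in>F. w p)"

lemma l1_energy_weighting: "l1_energy N F (\<lambda>q. q) w = M"
  unfolding l1_pairing_eq_left by (simp add: weighting M_def)

text \<open>The potential of \<open>w\<close> is 1 on \<open>F\<close>, so pairing \<open>u\<close>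
  with \<open>w\<close> returns the total mass of \<open>u\<close>, and \<open>w\<close> has energy
  \<open>M\<close>; the rest is Cauchy-Schwarz.\<close>

lemma square_sum_le_l1_energy: "(\<Sum>p\<in>F. u p)\<^sup>2 \<le> M * l1_energy N F (\<lambda>q. q) u"
proof -
  have "l1_pairing N F (\<lambda>q. q) w F (\<lambda>q. q) u = (\<Sum>p\<in>F. u p)"
    by (subst l1_pairing_commute, subst l1_pairing_eq_left) (simp add: weighting)
  then show ?thesis
    using l1_pairing_Cauchy_Schwarz[OF finite finite, of N "\<lambda>q. q" w "\<lambda>q. q" u]
    by (simp add: l1_energy_weighting)
qed

lemma M_pos: "0 < M"
proof -
  obtain p where p: "p \<in> F" using nonempty by blast
  have "0 \<le> M" using l1_energy_nonneg[OF finite, of N "\<lambda>q. q" w] by (simp add: l1_energy_weighting)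
  moreover have "M \<noteq> 0"
    using square_sum_le_l1_energy[of "\<lambda>q. if q = p then 1 else 0"] p finite by auto
  ultimately show ?thesis by simp
qed

end

section \<open>Perturbation of energies and pairings\<close>

lemma l1_energy_perturb:
  assumes "\<And>p. p \<in> F \<Longrightarrow> l1_dist N (y p) (z p) \<le> D"
  shows "\<bar>l1_energy N F y u - l1_energy N F z u\<bar> \<le> 2 * D * (\<Sum>p\<in>F. \<bar>u p\<bar>)\<^sup>2"
proof -
  have "\<bar>l1_energy N F y u - l1_energy N F z u\<bar>
      = \<bar>\<Sum>p\<in>F. \<Sum>q\<in>F. u p * u q * (l1_kernel N (y p) (y q) - l1_kernel N (z p) (z q))\<bar>"
    by (simp add: l1_pairing_def sum_subtractf right_diff_distrib)
  also have "\<dots> \<le> (\<Sum>p\<in>F. \<Sum>q\<in>F. \<bar>u p\<bar> * \<bar>u q\<bar> * (2 * D))"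
  proof (rule order_trans[OF sum_abs sum_mono], rule order_trans[OF sum_abs sum_mono])
    fix p q assume "p \<in> F" "q \<in> F"
    then have "\<bar>l1_kernel N (y p) (y q) - l1_kernel N (z p) (z q)\<bar> \<le> 2 * D"
      using l1_kernel_diff_le[of N "y p" "y q" "z p" "z q"] assms[of p] assms[of q] by linarith
    then show "\<bar>u p * u q * (l1_kernel N (y p) (y q) - l1_kernel N (z p) (z q))\<bar>
        \<le> \<bar>u p\<bar> * \<bar>u q\<bar> * (2 * D)"
      by (simp add: abs_mult mult_left_mono)
  qed
  also have "\<dots> = 2 * D * (\<Sum>p\<in>F. \<bar>u p\<bar>)\<^sup>2"
    unfolding power2_eq_square sum_product by (simp add: sum_distrib_left mult_ac)
  finally show ?thesis .
qed

text \<open>Serves to compare the energy of a discretisation with its own mass, and the pairing of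
  two families with the mass of one of them.\<close>

lemma l1_pairing_near_sum:
  assumes "\<And>j. j \<in> J \<Longrightarrow> \<bar>(\<Sum>i\<in>I. v i * l1_kernel N (x i) (y j)) - 1\<bar> \<le> \<eta>"
  shows "\<bar>l1_pairing N J y u I x v - (\<Sum>j\<in>J. u j)\<bar> \<le> \<eta> * (\<Sum>j\<in>J. \<bar>u j\<bar>)"
proof -
  have "l1_pairing N J y u I x v - (\<Sum>j\<in>J. u j)
      = (\<Sum>j\<in>J. u j * ((\<Sum>i\<in>I. v i * l1_kernel N (x i) (y j)) - 1))"
    by (simp add: l1_pairing_eq_left sum_subtractf right_diff_distrib)
  also have "\<bar>\<dots>\<bar> \<le> (\<Sum>j\<in>J. \<bar>u j\<bar> * \<eta>)"
    using assms
    by (intro order_trans[OF sum_abs sum_mono]) (simp add: abs_mult mult_left_mono)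
  finally show ?thesis by (simp only: mult.commute[of \<eta>] sum_distrib_right)
qed

section \<open>Estimates for approximate weightings\<close>

text \<open>The discretisations of a weight measure on \<open>K\<close> of total mass \<open>m\<close> and total variation at most
  \<open>V\<close>.\<close>

definition approx_l1_weighting :: "nat \<Rightarrow> (nat \<Rightarrow> real) set \<Rightarrow> real \<Rightarrow> real \<Rightarrow> bool" where
  "approx_l1_weighting N K m V \<longleftrightarrow> (\<forall>\<eta>>0. \<exists>(n :: nat) x v.
     (\<forall>i<n. x i \<in> K) \<and> (\<Sum>i<n. v i) = m \<and> (\<Sum>i<n. \<bar>v i\<bar>) \<le> V \<and>
     (\<forall>a\<in>K. \<bar>(\<Sum>i<n. v i * l1_kernel N (x i) a) - 1\<bar> \<le> \<eta>))"

lemma approx_l1_weightingD: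
  assumes "approx_l1_weighting N K m V" "0 < \<eta>"
  shows "\<exists>(n :: nat) x v. (\<forall>i<n. x i \<in> K) \<and> (\<Sum>i<n. v i) = m \<and> (\<Sum>i<n. \<bar>v i\<bar>) \<le> V \<and>
    (\<forall>a\<in>K. \<bar>(\<Sum>i<n. v i * l1_kernel N (x i) a) - 1\<bar> \<le> \<eta>) \<and>
    l1_energy N {..<n} x v \<le> m + \<eta> * V"
proof -
  obtain n :: nat and x v where *: "\<forall>i<n. x i \<in> K" "(\<Sum>i<n. v i) = m" "(\<Sum>i<n. \<bar>v i\<bar>) \<le> V"
    "\<forall>a\<in>K. \<bar>(\<Sum>i<n. v i * l1_kernel N (x i) a) - 1\<bar> \<le> \<eta>"
    using assms(1)[unfolded approx_l1_weighting_def, rule_format, OF assms(2)] by (elim exE conjE) (rule that)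
  have "\<bar>l1_energy N {..<n} x v - m\<bar> \<le> \<eta> * (\<Sum>i<n. \<bar>v i\<bar>)"
    unfolding *(2)[symmetric] by (rule l1_pairing_near_sum) (use * in auto)
  also have "\<dots> \<le> \<eta> * V" using *(3) assms(2) by simp
  finally have "l1_energy N {..<n} x v \<le> m + \<eta> * V" by linarith
  then show ?thesis using * by (intro exI[of _ n] exI[of _ x] exI[of _ v]) simp
qed

text \<open>This removes the discretisation error: \<open>c\<close> is built from the bound
  \<open>V\<close> on the variation, which does not depend on \<eta>.\<close>

lemma le_if_le_add_small_mult:
  fixes a b c :: real
  assumes "\<And>\<eta>. 0 < \<eta> \<Longrightarrow> a \<le> b + \<eta> * c"
  shows "a \<le> b"
proof (rule ccontr)
  assume "\<not> a \<le> b"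
  define \<eta> where "\<eta> = (a - b) / (\<bar>c\<bar> + 1)"
  have "0 < \<eta>" using \<open>\<not> a \<le> b\<close> by (simp add: \<eta>_def)
  have "\<eta> * c \<le> \<eta> * \<bar>c\<bar>" using \<open>0 < \<eta>\<close> by simp
  also have "\<dots> < \<eta> * (\<bar>c\<bar> + 1)" using \<open>0 < \<eta>\<close> by simp
  also have "\<dots> = a - b" by (simp add: \<eta>_def)
  finally show False using assms[OF \<open>0 < \<eta>\<close>] by simp
qed

text \<open>The pairing of a discretisation of the one with a discretisation of the other is
  symmetric and lies near both masses.\<close>

lemma approx_l1_weighting_unique:
  assumes "approx_l1_weighting N K m V" "approx_l1_weighting N K m' V'"
  shows "m = m'"
proof -
  have *: "m \<le> m'" if aw: "approx_l1_weighting N K m V" "approx_l1_weighting N K m' V'" for m m' V V'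
  proof (rule le_if_le_add_small_mult)
    fix \<eta> :: real assume \<eta>: "0 < \<eta>"
    obtain n :: nat and x v where x: "\<forall>i<n. x i \<in> K" "(\<Sum>i<n. v i) = m" "(\<Sum>i<n. \<bar>v i\<bar>) \<le> V"
        "\<forall>a\<in>K. \<bar>(\<Sum>i<n. v i * l1_kernel N (x i) a) - 1\<bar> \<le> \<eta>"
        "l1_energy N {..<n} x v \<le> m + \<eta> * V"
      using approx_l1_weightingD[OF aw(1) \<eta>] by (elim exE conjE) (rule that)
    obtain k :: nat and y u where y: "\<forall>i<k. y i \<in> K" "(\<Sum>i<k. u i) = m'" "(\<Sum>i<k. \<bar>u i\<bar>) \<le> V'"
        "\<forall>a\<in>K. \<bar>(\<Sum>i<k. u i * l1_kernel N (y i) a) - 1\<bar> \<le> \<eta>"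
        "l1_energy N {..<k} y u \<le> m' + \<eta> * V'"
      using approx_l1_weightingD[OF aw(2) \<eta>] by (elim exE conjE) (rule that)
    have "\<bar>l1_pairing N {..<n} x v {..<k} y u - m\<bar> \<le> \<eta> * (\<Sum>i<n. \<bar>v i\<bar>)"
      unfolding x(2)[symmetric] by (rule l1_pairing_near_sum) (use x y in auto)
    moreover have "\<bar>l1_pairing N {..<k} y u {..<n} x v - m'\<bar> \<le> \<eta> * (\<Sum>i<k. \<bar>u i\<bar>)"
      unfolding y(2)[symmetric] by (rule l1_pairing_near_sum) (use x y in auto)
    moreover have "\<eta> * (\<Sum>i<n. \<bar>v i\<bar>) \<le> \<eta> * V" "\<eta> * (\<Sum>i<k. \<bar>u i\<bar>) \<le> \<eta> * V'"
      using \<eta> x(3) y(3) by simp_all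
    ultimately have "m \<le> m' + \<eta> * V + \<eta> * V'"
      unfolding l1_pairing_commute[of N "{..<k}"] by linarith
    then show "m \<le> m' + \<eta> * (V + V')" by (simp add: ring_distribs)
  qed
  show ?thesis using *[OF assms] *[OF assms(2,1)] by simp
qed

section \<open>Bounds for the total mass on sets near a finite set\<close>

context finite_l1_weighting
begin

text \<open>\<open>w\<close> is placed at the points \<open>q p\<close> of \<open>K\<close>. There
  the discretisation has potential close to 1, so their pairing is close to \<open>M\<close>, while
  the energy of \<open>w\<close> has moved from \<open>M\<close> by at most
  \<open>2 * \<delta>\<close> times the squared variation of \<open>w\<close>.\<close>

lemma lower_bound:
  assumes aw: "approx_l1_weighting N K m V"
    and q: "\<And>p. p \<in> F \<Longrightarrow> q p \<in> K" "\<And>p. p \<in> F \<Longrightarrow> l1_dist N (q p) p \<le> \<delta>"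
  shows "M\<^sup>2 \<le> (M + 2 * \<delta> * (\<Sum>p\<in>F. \<bar>w p\<bar>)\<^sup>2) * m"
proof (rule le_if_le_add_small_mult)
  fix \<eta> :: real assume \<eta>: "0 < \<eta>"
  define W where "W = (\<Sum>p\<in>F. \<bar>w p\<bar>)"
  obtain n :: nat and x v where x: "\<forall>i<n. x i \<in> K" "(\<Sum>i<n. v i) = m" "(\<Sum>i<n. \<bar>v i\<bar>) \<le> V"
      "\<forall>a\<in>K. \<bar>(\<Sum>i<n. v i * l1_kernel N (x i) a) - 1\<bar> \<le> \<eta>"
      "l1_energy N {..<n} x v \<le> m + \<eta> * V"
    using approx_l1_weightingD[OF aw \<eta>] by (elim exE conjE) (rule that)
  define b where "b = l1_pairing N F q w {..<n} x v"
  define C where "C = M + 2 * \<delta> * W\<^sup>2"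
  have "\<bar>b - M\<bar> \<le> \<eta> * W"
    unfolding b_def M_def W_def by (rule l1_pairing_near_sum) (use q x in auto)
  then have "2 * M * (M - b) \<le> 2 * M * (\<eta> * W)" using M_pos by (intro mult_left_mono) auto
  \<comment> \<open>Expanding this square bounds the square of \<open>b\<close> from below by that
    of \<open>M\<close> with an error linear in \<eta>, whatever the sign of
    \<open>b\<close>.\<close>
  moreover have "0 \<le> (b - M)\<^sup>2" by simp
  ultimately have "M\<^sup>2 - 2 * M * (\<eta> * W) \<le> b\<^sup>2" by (simp add: power2_eq_square algebra_simps)
  also have "\<dots> \<le> l1_energy N F q w * l1_energy N {..<n} x v"
    unfolding b_def using finite by (intro l1_pairing_Cauchy_Schwarz) auto
  also have "\<dots> \<le> C * (m + \<eta> * V)"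
  proof (rule mult_mono)
    have "\<bar>l1_energy N F q w - l1_energy N F (\<lambda>q. q) w\<bar> \<le> 2 * \<delta> * W\<^sup>2"
      unfolding W_def by (rule l1_energy_perturb) (rule q)
    then show le: "l1_energy N F q w \<le> C" by (simp add: l1_energy_weighting C_def)
    show "0 \<le> C" using l1_energy_nonneg[OF finite, of N q w] le by linarith
  qed (use x(5) l1_energy_nonneg in auto)
  finally have "M\<^sup>2 \<le> C * m + \<eta> * (C * V + 2 * M * W)" by (simp add: algebra_simps)
  then show "M\<^sup>2 \<le> (M + 2 * \<delta> * (\<Sum>p\<in>F. \<bar>w p\<bar>)\<^sup>2) * m + \<eta> * (C * V + 2 * M * W)"
    by (simp add: C_def W_def)
qed

text \<open>\<open>D\<close> bounds the displacement of the points of \<open>F\<close> as well as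
  the exponent of the energy growth under the collapse. The perturbation error involves the
  variation of the push-forward \<open>u\<close>. Bounding it by \<open>V\<close> would make the
  estimate depend on the measure; \<open>A\<close> bounds it by the energy of \<open>u\<close>
  instead, and the error moves to the left as the factor \<open>1 - 2 * D * A\<close>.\<close>

lemma upper_bound:
  assumes aw: "approx_l1_weighting N K m V"
    and A: "\<And>u. (\<Sum>p\<in>F. \<bar>u p\<bar>)\<^sup>2 \<le> A * l1_energy N F (\<lambda>q. q) u" "0 \<le> A"
    and gap: "\<And>p q k. p \<in> F \<Longrightarrow> q \<in> F \<Longrightarrow> k < N \<Longrightarrow> p k \<noteq> q k \<Longrightarrow> 2 * \<delta> \<le> \<bar>p k - q k\<bar>"
    and \<pi>: "\<And>a. a \<in> K \<Longrightarrow> \<pi> a \<in> F" "\<And>a. a \<in> K \<Longrightarrow> l1_dist N a (\<pi> a) \<le> \<delta>"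
    and \<delta>: "0 \<le> \<delta>" and D: "D = 2 * \<delta> * card F * N" "2 * D * A \<le> 1"
  shows "(1 - 2 * D * A) * m\<^sup>2 \<le> M * exp D * m"
proof (rule le_if_le_add_small_mult)
  fix \<eta> :: real assume \<eta>: "0 < \<eta>"
  obtain n :: nat and x v where x: "\<forall>i<n. x i \<in> K" "(\<Sum>i<n. v i) = m"
      "(\<Sum>i<n. \<bar>v i\<bar>) \<le> V"
      "\<forall>a\<in>K. \<bar>(\<Sum>i<n. v i * l1_kernel N (x i) a) - 1\<bar> \<le> \<eta>"
      "l1_energy N {..<n} x v \<le> m + \<eta> * V"
    using approx_l1_weightingD[OF aw \<eta>] by (elim exE conjE) (rule that)
  define u where "u p = (\<Sum>i\<in>{i \<in> {..<n}. \<pi> (x i) = p}. v i)" for p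
  let ?E = "l1_energy N F (\<lambda>q. q) u"
  have "\<exists>y. (\<forall>p\<in>F. l1_dist N (y p) p \<le> D) \<and>
      l1_energy N F y u \<le> exp D * l1_energy N {..<n} x v"
    unfolding u_def D(1) by (rule l1_energy_ge_near_finite) (use \<pi> x(1) finite \<delta> gap in auto)
  then obtain y where y: "\<And>p. p \<in> F \<Longrightarrow> l1_dist N (y p) p \<le> D"
      "l1_energy N F y u \<le> exp D * l1_energy N {..<n} x v" by blast
  have "m = (\<Sum>p\<in>F. u p)"
    unfolding u_def x(2)[symmetric] using \<pi> x(1) by (intro sum.group[symmetric] finite) auto
  then have "m\<^sup>2 \<le> M * ?E" using square_sum_le_l1_energy by simp
  moreover have "\<bar>l1_energy N F y u - ?E\<bar> \<le> 2 * D * (\<Sum>p\<in>F. \<bar>u p\<bar>)\<^sup>2"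
    by (rule l1_energy_perturb) (rule y)
  moreover have "2 * D * (\<Sum>p\<in>F. \<bar>u p\<bar>)\<^sup>2 \<le> 2 * D * (A * ?E)"
    using \<delta> by (intro mult_left_mono A) (simp add: D)
  moreover have "exp D * l1_energy N {..<n} x v \<le> exp D * (m + \<eta> * V)"
    using x(5) by simp
  ultimately have "(1 - 2 * D * A) * ?E \<le> exp D * (m + \<eta> * V)"
    using y(2) by (simp add: algebra_simps)
  have "(1 - 2 * D * A) * m\<^sup>2 \<le> (1 - 2 * D * A) * (M * ?E)"
    using D \<open>m\<^sup>2 \<le> M * ?E\<close> by (intro mult_left_mono) auto
  also have "\<dots> = M * ((1 - 2 * D * A) * ?E)" by simp
  also have "\<dots> \<le> M * (exp D * (m + \<eta> * V))"
    using M_pos \<open>(1 - 2 * D * A) * ?E \<le> exp D * (m + \<eta> * V)\<close> by (intro mult_left_mono) auto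
  finally show "(1 - 2 * D * A) * m\<^sup>2 \<le> M * exp D * m + \<eta> * (M * exp D * V)"
    by (simp add: algebra_simps)
qed

text \<open>Both bounds tend to \<open>M\<close> as \<delta> tends to 0 from the right, and they
  involve neither \<open>K\<close> nor \<open>V\<close>, so one \<delta> serves all sets and
  measures.\<close>

lemma approx_l1_weighting_near:
  assumes "0 < e"
  shows "\<exists>\<delta>>0. \<forall>K m V. approx_l1_weighting N K m V \<longrightarrow>
    (\<forall>p\<in>F. \<exists>a\<in>K. l1_dist N p a < \<delta>) \<longrightarrow> (\<forall>a\<in>K. \<exists>p\<in>F. l1_dist N a p < \<delta>) \<longrightarrow> \<bar>m - M\<bar> < e"
proof -
  obtain A where A: "\<And>u. (\<Sum>p\<in>F. \<bar>u p\<bar>)\<^sup>2 \<le> A * l1_energy N F (\<lambda>q. q) u" "0 \<le> A"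
    using square_sum_abs_le_l1_energy[OF finite l1_space] by blast
  obtain h where h: "0 < h" "\<And>p q k. p \<in> F \<Longrightarrow> q \<in> F \<Longrightarrow> k < N \<Longrightarrow> p k \<noteq> q k \<Longrightarrow> h \<le> \<bar>p k - q k\<bar>"
    using ex_coordinate_gap[OF finite, of N] by blast
  define W where "W = (\<Sum>p\<in>F. \<bar>w p\<bar>)"
  define D where "D \<delta> = 2 * \<delta> * card F * N" for \<delta> :: real
  have lo: "((\<lambda>\<delta>. M\<^sup>2 / (M + 2 * \<delta> * W\<^sup>2)) \<longlongrightarrow> M\<^sup>2 / (M + 2 * 0 * W\<^sup>2)) (at_right 0)"
    using M_pos by (intro tendsto_intros) auto
  have up: "((\<lambda>\<delta>. M * exp (D \<delta>) / (1 - 2 * D \<delta> * A)) \<longlongrightarrow> M * exp (D 0) / (1 - 2 * D 0 * A)) (at_right 0)"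
    unfolding D_def by (intro tendsto_intros) auto
  have DA: "((\<lambda>\<delta>. 2 * D \<delta> * A) \<longlongrightarrow> 2 * D 0 * A) (at_right 0)"
    unfolding D_def by (intro tendsto_intros)
  have "eventually (\<lambda>\<delta>. 0 < \<delta> \<and> 2 * \<delta> < h \<and> M - e < M\<^sup>2 / (M + 2 * \<delta> * W\<^sup>2) \<and>
      M * exp (D \<delta>) / (1 - 2 * D \<delta> * A) < M + e \<and> 2 * D \<delta> * A < 1) (at_right 0)"
  proof (intro eventually_conj)
    show "eventually (\<lambda>\<delta>. 2 * \<delta> < h) (at_right 0)"
      using h(1) by (intro eventually_at_rightI[of 0 "h / 2"]) auto
    show "eventually (\<lambda>\<delta>. M - e < M\<^sup>2 / (M + 2 * \<delta> * W\<^sup>2)) (at_right 0)"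
      using M_pos assms by (intro order_tendstoD(1)[OF lo]) (simp add: power2_eq_square)
    show "eventually (\<lambda>\<delta>. M * exp (D \<delta>) / (1 - 2 * D \<delta> * A) < M + e) (at_right 0)"
      using assms by (intro order_tendstoD(2)[OF up]) (simp add: D_def)
    show "eventually (\<lambda>\<delta>. 2 * D \<delta> * A < 1) (at_right 0)"
      by (intro order_tendstoD(2)[OF DA]) (simp add: D_def)
  qed (rule eventually_at_right_less)
  then obtain \<delta> where \<delta>: "0 < \<delta>" "2 * \<delta> < h" "M - e < M\<^sup>2 / (M + 2 * \<delta> * W\<^sup>2)"
      "M * exp (D \<delta>) / (1 - 2 * D \<delta> * A) < M + e" "2 * D \<delta> * A < 1"
    using eventually_happens[of _ "at_right (0 :: real)"] by (auto simp: trivial_limit_at_right_real)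
  show ?thesis
  proof (intro exI[of _ \<delta>] conjI allI impI \<open>0 < \<delta>\<close>)
    fix K m V
    assume aw: "approx_l1_weighting N K m V"
      and near: "\<forall>p\<in>F. \<exists>a\<in>K. l1_dist N p a < \<delta>" "\<forall>a\<in>K. \<exists>p\<in>F. l1_dist N a p < \<delta>"
    have "\<forall>p\<in>F. \<exists>a. a \<in> K \<and> l1_dist N a p \<le> \<delta>" "\<forall>a\<in>K. \<exists>p. p \<in> F \<and> l1_dist N a p \<le> \<delta>"
      using near by (force simp: l1.commute dest: less_imp_le)+
    then obtain q \<pi> where "\<forall>p\<in>F. q p \<in> K \<and> l1_dist N (q p) p \<le> \<delta>"
      and "\<forall>a\<in>K. \<pi> a \<in> F \<and> l1_dist N a (\<pi> a) \<le> \<delta>"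
      by (elim bchoice[THEN exE]) (rule that)
    then have q: "p \<in> F \<Longrightarrow> q p \<in> K" "p \<in> F \<Longrightarrow> l1_dist N (q p) p \<le> \<delta>"
      and \<pi>: "a \<in> K \<Longrightarrow> \<pi> a \<in> F" "a \<in> K \<Longrightarrow> l1_dist N a (\<pi> a) \<le> \<delta>" for p a
      by auto
    have "M\<^sup>2 \<le> (M + 2 * \<delta> * W\<^sup>2) * m" unfolding W_def by (rule lower_bound[OF aw q])
    moreover have pos: "0 < M + 2 * \<delta> * W\<^sup>2" using M_pos \<delta>(1) by (simp add: add_pos_nonneg)
    ultimately have le: "M\<^sup>2 / (M + 2 * \<delta> * W\<^sup>2) \<le> m" by (simp add: divide_le_eq mult.commute)
    moreover have "0 < M\<^sup>2 / (M + 2 * \<delta> * W\<^sup>2)" using pos M_pos by simp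
    \<comment> \<open>The upper bound is quadratic in \<open>m\<close>; positivity, known from the
      lower bound, allows division by \<open>m\<close>.\<close>
    ultimately have "0 < m" by linarith
    have "(1 - 2 * D \<delta> * A) * m\<^sup>2 \<le> M * exp (D \<delta>) * m"
    proof (rule upper_bound[OF aw A _ \<pi>])
      fix p q k assume "p \<in> F" "q \<in> F" "k < N" "p k \<noteq> q k"
      then show "2 * \<delta> \<le> \<bar>p k - q k\<bar>" using h(2)[of p q k] \<delta>(2) by linarith
    qed (use \<delta> D_def in auto)
    then have "(1 - 2 * D \<delta> * A) * m \<le> M * exp (D \<delta>)"
      using \<open>0 < m\<close> by (simp add: power2_eq_square flip: mult.assoc)
    then have "m \<le> M * exp (D \<delta>) / (1 - 2 * D \<delta> * A)"
      using \<delta>(5) by (simp add: le_divide_eq mult.commute)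
    then show "\<bar>m - M\<bar> < e" using le \<delta>(3,4) by linarith
  qed
qed

end

section \<open>Finite signed measures are differences of finite measures\<close>

lemma finite_signed_measure_Diff:
  assumes "finite_signed_measure M \<omega>" "A \<in> sets M" "B \<in> sets M" "B \<subseteq> A"
  shows "\<omega> (A - B) = \<omega> A - \<omega> B"
  using finite_signed_measure_Un[OF assms(1,3), of "A - B"] assms by (simp add: Un_absorb1)

text \<open>A set on which \<open>\<omega>\<close> is unbounded splits off a piece of measure at least 1 in modulus such that
  \<open>\<omega>\<close> is still unbounded on the rest; infinitely many such pieces contradict summability.\<close>

lemma finite_signed_measure_bounded:
  assumes \<omega>: "finite_signed_measure M \<omega>"
  shows "\<exists>C. \<forall>B\<in>sets M. \<bar>\<omega> B\<bar> \<le> C"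
proof (rule ccontr)
  assume nb: "\<not> ?thesis"
  define U where "U A \<longleftrightarrow> A \<in> sets M \<and> (\<forall>c. \<exists>B\<in>sets M. B \<subseteq> A \<and> c < \<bar>\<omega> B\<bar>)" for A
  have "U (space M)"
    unfolding U_def
  proof (intro conjI allI sets.top)
    fix c
    obtain B where "B \<in> sets M" "c < \<bar>\<omega> B\<bar>" using nb by (auto simp: not_le)
    then show "\<exists>B\<in>sets M. B \<subseteq> space M \<and> c < \<bar>\<omega> B\<bar>" using sets.sets_into_space by blast
  qed
  have step: "\<exists>A'. U A' \<and> A' \<subseteq> A \<and> 1 \<le> \<bar>\<omega> (A - A')\<bar>" if A: "U A" for A
  proof -
    \<comment> \<open>By this margin both \<open>B\<close> and \<open>A - B\<close> have measure
      above 1 in modulus, so either can be split off while the other, unbounded one is kept.\<close>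
    obtain B where B: "B \<in> sets M" "B \<subseteq> A" "\<bar>\<omega> A\<bar> + 1 < \<bar>\<omega> B\<bar>" using A by (auto simp: U_def)
    have AM: "A \<in> sets M" using A by (simp add: U_def)
    have diff: "\<omega> (A - B) = \<omega> A - \<omega> B" by (rule finite_signed_measure_Diff[OF \<omega> AM B(1,2)])
    have "U B \<or> U (A - B)"
    proof (rule ccontr)
      assume "\<not> (U B \<or> U (A - B))"
      then have "\<not> U B" "\<not> U (A - B)" by auto
      obtain c where c: "\<And>C. C \<in> sets M \<Longrightarrow> C \<subseteq> B \<Longrightarrow> \<bar>\<omega> C\<bar> \<le> c"
        using \<open>\<not> U B\<close> B(1) by (auto simp: U_def not_less)
      obtain d where d: "\<And>C. C \<in> sets M \<Longrightarrow> C \<subseteq> A - B \<Longrightarrow> \<bar>\<omega> C\<bar> \<le> d"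
        using \<open>\<not> U (A - B)\<close> sets.Diff[OF AM B(1)] unfolding U_def not_less by (metis not_le)
      obtain C where C: "C \<in> sets M" "C \<subseteq> A" "c + d < \<bar>\<omega> C\<bar>" using A by (auto simp: U_def)
      have "\<omega> (C - (C \<inter> B)) = \<omega> C - \<omega> (C \<inter> B)"
        using B C by (intro finite_signed_measure_Diff[OF \<omega>]) auto
      moreover have "\<bar>\<omega> (C \<inter> B)\<bar> \<le> c" using B C by (intro c) auto
      moreover have "\<bar>\<omega> (C - (C \<inter> B))\<bar> \<le> d" using B C by (intro d) auto
      ultimately show False using C(3) by linarith
    qed
    then show ?thesis
    proof
      assume "U B"
      then show ?thesis using B diff by (intro exI[of _ B]) auto
    next
      assume "U (A - B)"
      moreover have "A - (A - B) = B" using B by auto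
      ultimately show ?thesis using B by (intro exI[of _ "A - B"]) auto
    qed
  qed
  have "\<exists>A. \<forall>n. U (A n) \<and> (A (Suc n) \<subseteq> A n \<and> 1 \<le> \<bar>\<omega> (A n - A (Suc n))\<bar>)"
    using \<open>U (space M)\<close> step by (intro dependent_nat_choice) auto
  then obtain A where A: "\<And>n. U (A n)" "\<And>n. A (Suc n) \<subseteq> A n" "\<And>n. 1 \<le> \<bar>\<omega> (A n - A (Suc n))\<bar>"
    by blast
  define D where "D n = A n - A (Suc n)" for n
  have "decseq A" using A(2) by (rule decseq_SucI)
  have "D i \<inter> D j = {}" if "i < j" for i j
    using decseqD[OF \<open>decseq A\<close>, of "Suc i" j] that by (auto simp: D_def)
  then have "disjoint_family D"
    by (auto simp: disjoint_family_on_def) (metis disjoint_iff linorder_neqE_nat)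
  moreover have "range D \<subseteq> sets M" using A(1) by (auto simp: D_def U_def)
  ultimately have "(\<lambda>i. \<omega> (D i)) sums \<omega> (\<Union>i. D i)"
    using \<omega> unfolding finite_signed_measure_def by blast
  then have "(\<lambda>i. \<omega> (D i)) \<longlonglongrightarrow> 0" by (intro summable_LIMSEQ_zero sums_summable)
  then have "eventually (\<lambda>i. norm (\<omega> (D i)) < 1) sequentially"
    by (intro order_tendstoD(2)[OF tendsto_norm_zero]) simp_all
  then obtain i where "norm (\<omega> (D i)) < 1" using eventually_happens by fastforce
  then show False using A(3)[of i] by (simp add: D_def)
qed

section \<open>Jordan decomposition\<close>

lemma finite_measure_positive_variation:
  assumes \<omega>: "finite_signed_measure M \<omega>"
  shows "finite_measure (positive_variation M \<omega>)"
proof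
  obtain C where C: "\<forall>B\<in>sets M. \<bar>\<omega> B\<bar> \<le> C" using finite_signed_measure_bounded[OF \<omega>] by blast
  have "emeasure (positive_variation M \<omega>) (space M) \<le> ennreal C"
    unfolding emeasure_positive_variation[OF \<omega> sets.top]
    using C by (intro SUP_least ennreal_leI) (auto dest: abs_le_D1)
  then show "emeasure (positive_variation M \<omega>) (space (positive_variation M \<omega>)) \<noteq> \<infinity>"
    by (auto simp: top_unique)
qed

lemma le_measure_positive_variation:
  assumes \<omega>: "finite_signed_measure M \<omega>" and A: "A \<in> sets M" and B: "B \<in> sets M" "B \<subseteq> A"
  shows "\<omega> B \<le> measure (positive_variation M \<omega>) A"
proof -
  interpret finite_measure "positive_variation M \<omega>"
    by (rule finite_measure_positive_variation[OF \<omega>])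
  have "ennreal (\<omega> B) \<le> emeasure (positive_variation M \<omega>) A"
    unfolding emeasure_positive_variation[OF \<omega> A] using B by (intro SUP_upper) auto
  then show ?thesis by (simp add: emeasure_eq_measure)
qed

lemma measure_positive_variation_le:
  assumes \<omega>: "finite_signed_measure M \<omega>" and A: "A \<in> sets M"
    and c: "\<And>B. B \<in> sets M \<Longrightarrow> B \<subseteq> A \<Longrightarrow> \<omega> B \<le> c"
  shows "measure (positive_variation M \<omega>) A \<le> c"
proof -
  interpret finite_measure "positive_variation M \<omega>"
    by (rule finite_measure_positive_variation[OF \<omega>])
  have "0 \<le> c" using c[of "{}"] \<omega> by (simp add: finite_signed_measure_def)
  moreover have "emeasure (positive_variation M \<omega>) A \<le> ennreal c"
    unfolding emeasure_positive_variation[OF \<omega> A] using c by (intro SUP_least ennreal_leI) auto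
  ultimately show ?thesis by (simp add: emeasure_eq_measure)
qed

text \<open>For \<open>B\<close> inside \<open>A\<close>,
  \<open>\<omega> B = \<omega> A - \<omega> (A - B)\<close>, and the supremum over \<open>B\<close>
  gives one inequality. The other is the same inequality for \<open>- \<omega>\<close>.\<close>

lemma Jordan_decomposition:
  assumes \<omega>: "finite_signed_measure M \<omega>" and A: "A \<in> sets M"
  shows "\<omega> A = measure (positive_variation M \<omega>) A - measure (positive_variation M (\<lambda>A. - \<omega> A)) A"
proof -
  have *: "measure (positive_variation M \<omega>) A \<le> \<omega> A + measure (positive_variation M (\<lambda>A. - \<omega> A)) A"
    if \<omega>: "finite_signed_measure M \<omega>" for \<omega>
  proof (rule measure_positive_variation_le[OF \<omega> A])
    fix B assume B: "B \<in> sets M" "B \<subseteq> A"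
    have "- \<omega> (A - B) \<le> measure (positive_variation M (\<lambda>A. - \<omega> A)) A"
      using A B by (intro le_measure_positive_variation[OF finite_signed_measure_uminus[OF \<omega>]]) auto
    then show "\<omega> B \<le> \<omega> A + measure (positive_variation M (\<lambda>A. - \<omega> A)) A"
      using finite_signed_measure_Diff[OF \<omega> A B] by simp
  qed
  show ?thesis using *[OF \<omega>] *[OF finite_signed_measure_uminus[OF \<omega>]] by simp
qed

section \<open>Approximating signed integrals by finite sums\<close>

lemma integral_near_step_function:
  fixes f :: "'a \<Rightarrow> real"
  assumes P: "finite_measure P" and f: "f \<in> borel_measurable P" "\<And>x. x \<in> space P \<Longrightarrow> \<bar>f x\<bar> \<le> C"
    and I: "finite I" "\<And>i. i \<in> I \<Longrightarrow> B i \<in> sets P" "disjoint_family_on B I" "(\<Union>i\<in>I. B i) = space P"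
    and r: "\<And>i x. i \<in> I \<Longrightarrow> x \<in> B i \<Longrightarrow> \<bar>f x - \<alpha> i\<bar> \<le> r"
  shows "\<bar>integral\<^sup>L P f - (\<Sum>i\<in>I. \<alpha> i * measure P (B i))\<bar> \<le> r * measure P (space P)"
proof -
  interpret finite_measure P by (rule P)
  define s where "s x = (\<Sum>i\<in>I. \<alpha> i * indicator (B i) x)" for x
  have s: "s x = \<alpha> i" if "i \<in> I" "x \<in> B i" for i x
  proof -
    have "indicator (B j) x = (if j = i then 1 else 0 :: real)" if "j \<in> I" for j
      using disjoint_family_onD[OF I(3) that \<open>i \<in> I\<close>] \<open>x \<in> B i\<close> by (auto simp: indicator_def)
    then have "s x = (\<Sum>j\<in>I. if j = i then \<alpha> j else 0)" unfolding s_def by (intro sum.cong) auto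
    then show ?thesis using that I(1) by simp
  qed
  have int_f: "integrable P f" using f by (intro integrable_const_bound[of _ C]) auto
  have int_ind: "integrable P (\<lambda>x. \<alpha> i * indicator (B i) x)" if "i \<in> I" for i
    using I(2)[OF that] by (intro integrable_mult_right integrable_real_indicator)
      (auto simp: emeasure_eq_measure)
  have int_s: "integrable P s" unfolding s_def by (intro Bochner_Integration.integrable_sum int_ind)
  have "integral\<^sup>L P s = (\<Sum>i\<in>I. \<alpha> i * measure P (B i))"
    unfolding s_def using int_ind I(2) sets.sets_into_space
    by (subst Bochner_Integration.integral_sum) (auto intro!: sum.cong simp: Int_absorb2)
  then have "\<bar>integral\<^sup>L P f - (\<Sum>i\<in>I. \<alpha> i * measure P (B i))\<bar> = \<bar>integral\<^sup>L P (\<lambda>x. f x - s x)\<bar>"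
    using int_f int_s by simp
  also have "\<dots> \<le> integral\<^sup>L P (\<lambda>x. \<bar>f x - s x\<bar>)" by (rule integral_abs_bound)
  also have "\<dots> \<le> integral\<^sup>L P (\<lambda>x. r)"
  proof (rule integral_mono)
    fix x assume "x \<in> space P"
    then obtain i where "i \<in> I" "x \<in> B i" using I(4) by auto
    then show "\<bar>f x - s x\<bar> \<le> r" using r s by simp
  qed (use int_f int_s in auto)
  also have "\<dots> = r * measure P (space P)" by simp
  finally show ?thesis .
qed

text \<open>Used along a fine partition to discretise a weight measure, and with
  \<open>r = 0\<close> to evaluate integrals over a finite set exactly.\<close>

lemma signed_integral_near_step_function:
  fixes f :: "'a \<Rightarrow> real"
  assumes \<omega>: "finite_signed_measure M \<omega>"
    and f: "f \<in> borel_measurable M" "\<And>x. x \<in> space M \<Longrightarrow> \<bar>f x\<bar> \<le> C"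
    and I: "finite I" "\<And>i. i \<in> I \<Longrightarrow> B i \<in> sets M" "disjoint_family_on B I" "(\<Union>i\<in>I. B i) = space M"
    and r: "\<And>i x. i \<in> I \<Longrightarrow> x \<in> B i \<Longrightarrow> \<bar>f x - \<alpha> i\<bar> \<le> r"
  shows "\<bar>signed_integral M \<omega> f - (\<Sum>i\<in>I. \<alpha> i * \<omega> (B i))\<bar> \<le>
    r * (measure (positive_variation M \<omega>) (space M)
      + measure (positive_variation M (\<lambda>A. - \<omega> A)) (space M))"
proof -
  let ?P = "positive_variation M \<omega>" and ?Q = "positive_variation M (\<lambda>A. - \<omega> A)"
  note \<omega>' = finite_signed_measure_uminus[OF \<omega>]
  have meas: "f \<in> borel_measurable (positive_variation M \<omega>)" for \<omega>
    using f(1) by (simp add: measurable_def)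
  have 1: "\<bar>integral\<^sup>L ?P f - (\<Sum>i\<in>I. \<alpha> i * measure ?P (B i))\<bar> \<le> r * measure ?P (space ?P)"
    by (rule integral_near_step_function[where C = C])
      (use assms meas finite_measure_positive_variation[OF \<omega>] in auto)
  have 2: "\<bar>integral\<^sup>L ?Q f - (\<Sum>i\<in>I. \<alpha> i * measure ?Q (B i))\<bar> \<le> r * measure ?Q (space ?Q)"
    by (rule integral_near_step_function[where C = C])
      (use assms meas finite_measure_positive_variation[OF \<omega>'] in auto)
  have "(\<Sum>i\<in>I. \<alpha> i * \<omega> (B i)) = (\<Sum>i\<in>I. \<alpha> i * measure ?P (B i)) - (\<Sum>i\<in>I. \<alpha> i * measure ?Q (B i))"
    unfolding sum_subtractf[symmetric]
    by (intro sum.cong refl) (simp add: Jordan_decomposition[OF \<omega> I(2)] right_diff_distrib)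
  then show ?thesis using 1 2 unfolding signed_integral_def by (simp add: ring_distribs)
qed

section \<open>Weight measures and continuity of magnitude\<close>

lemma space_l1_borel [simp]: "space (l1_borel N K) = K"
  unfolding l1_borel_def by (rule space_measure_of) (auto dest: openin_imp_subset)

lemma l1_borel_openin: "openin (l1.mtopology N) U \<Longrightarrow> K \<inter> U \<in> sets (l1_borel N K)"
  unfolding l1_borel_def
  by (subst sets_measure_of) (auto dest: openin_imp_subset intro: openin_subtopology_Int2)

lemma l1_kernel_measurable:
  assumes "K \<subseteq> l1_space N"
  shows "(\<lambda>x. l1_kernel N x a) \<in> borel_measurable (l1_borel N K)"
proof (rule borel_measurableI)
  fix S :: "real set" assume "open S"
  have "openin (l1.mtopology N) {x \<in> l1_space N. l1_kernel N x a \<in> S}"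
    unfolding l1.openin_mtopology
  proof (intro conjI allI impI)
    fix x assume x: "x \<in> {x \<in> l1_space N. l1_kernel N x a \<in> S}"
    then obtain r where r: "0 < r" "ball (l1_kernel N x a) r \<subseteq> S"
      using \<open>open S\<close> by (auto simp: open_contains_ball)
    have "l1_kernel N y a \<in> S" if "l1_dist N x y < r" for y
      using l1_kernel_diff_le[of N x a y a] that r(2) by (auto simp: dist_real_def l1_dist_def subset_eq)
    then show "\<exists>r>0. l1.mball N x r \<subseteq> {x \<in> l1_space N. l1_kernel N x a \<in> S}"
      using r(1) by (intro exI[of _ r]) auto
  qed auto
  from l1_borel_openin[OF this, of K]
  have "K \<inter> {x \<in> l1_space N. l1_kernel N x a \<in> S} \<in> sets (l1_borel N K)" .
  moreover have "K \<inter> {x \<in> l1_space N. l1_kernel N x a \<in> S} = (\<lambda>x. l1_kernel N x a) -` S \<inter> K"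
    using assms by auto
  ultimately show "(\<lambda>x. l1_kernel N x a) -` S \<inter> space (l1_borel N K) \<in> sets (l1_borel N K)"
    by simp
qed

text \<open>Total boundedness cuts \<open>K\<close> into finitely many Borel pieces, each within
  \<open>r\<close> of a point of \<open>K\<close> at which its mass is placed. The kernel is
  1-Lipschitz uniformly in \<open>a\<close>, so potentials on \<open>K\<close> change by at most
  \<open>r * V\<close>, with \<open>V\<close> the sum of the masses of both Jordan parts.\<close>

lemma approx_l1_weighting_weight_measure:
  assumes K: "K \<in> l1.nonempty_compacts N" and \<omega>: "weight_measure N K \<omega>"
  shows "\<exists>V. approx_l1_weighting N K (\<omega> K) V"
proof -
  let ?B = "l1_borel N K"
  define P Q where "P = positive_variation ?B \<omega>" and "Q = positive_variation ?B (\<lambda>A. - \<omega> A)"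
  define V where "V = measure P K + measure Q K"
  have sm: "finite_signed_measure ?B \<omega>" and int: "\<And>a. a \<in> K \<Longrightarrow> signed_integral ?B \<omega> (\<lambda>x. l1_kernel N x a) = 1"
    using \<omega> by (auto simp: weight_measure_def l1_kernel_def)
  have KM: "K \<subseteq> l1_space N" using l1.nonempty_compactsD(2)[OF K] .
  have PQ: "finite_measure P" "finite_measure Q"
    unfolding P_def Q_def
    by (intro finite_measure_positive_variation finite_signed_measure_uminus sm)+
  show ?thesis
  proof (intro exI[of _ V] approx_l1_weighting_def[THEN iffD2] allI impI)
    fix \<eta> :: real assume \<eta>: "0 < \<eta>"
    \<comment> \<open>The summand 1 excludes division by zero, as only \<open>0 \<le> V\<close> is
      known.\<close>
    define r where "r = \<eta> / (V + 1)"
    have "0 \<le> V" by (simp add: V_def)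
    then have r: "0 < r" "r * V \<le> \<eta>" using \<eta> by (auto simp: r_def field_simps)
    have "l1.mtotally_bounded N K"
      using l1.nonempty_compactsD(3)[OF K] by (rule l1.compactin_imp_mtotally_bounded)
    then have "\<exists>E. finite E \<and> E \<subseteq> K \<and> K \<subseteq> (\<Union>x\<in>E. l1.mball N x r)"
      using r(1) by (simp add: l1.mtotally_bounded_def)
    then obtain E where E: "finite E" "E \<subseteq> K" "K \<subseteq> (\<Union>x\<in>E. l1.mball N x r)" by blast
    obtain x where x: "bij_betw x {..<card E} E"
      using ex_bij_betw_nat_finite[OF E(1)] by (auto simp: atLeast0LessThan)
    define n where "n = card E"
    define U where "U i = K \<inter> l1.mball N (x i) r" for i
    define S where "S = disjointed U"
    have xK: "x i \<in> K" if "i < n" for i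
      using bij_betwE[OF x] that E(2) by (auto simp: n_def)
    have range: "range U \<subseteq> sets ?B" unfolding U_def by (auto intro: l1_borel_openin l1.openin_mball)
    have S: "S i \<in> sets ?B" for i
      using sets.range_disjointed_sets[OF range] by (auto simp: S_def)
    have un: "(\<Union>i\<in>{..<n}. S i) = K"
    proof -
      have "(\<Union>i\<in>{..<n}. S i) = (\<Union>i\<in>{..<n}. U i)"
        unfolding S_def lessThan_atLeast0 by (rule finite_UN_disjointed_eq)
      also have "\<dots> = K"
      proof -
        have "x ` {..<n} = E" using bij_betw_imp_surj_on[OF x] by (simp add: n_def)
        then show ?thesis using E(3) unfolding U_def by blast
      qed
      finally show ?thesis .
    qed
    have disj: "disjoint_family_on S {..<n}"
      unfolding S_def by (rule disjoint_family_on_mono[OF _ disjoint_family_disjointed]) simp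
    have near: "\<bar>l1_kernel N y a - l1_kernel N (x i) a\<bar> \<le> r" if "y \<in> S i" for y a i
    proof -
      have "y \<in> U i" using that disjointed_subset[of U i] by (auto simp: S_def)
      then show ?thesis
        using l1_kernel_diff_le[of N y a "x i" a] l1.commute[of N y "x i"]
        by (simp add: U_def l1_dist_def)
    qed
    have fin_un: "measure R K = (\<Sum>i<n. measure R (S i))" if "finite_measure R" "sets R = sets ?B" for R
    proof -
      interpret finite_measure R by (rule that(1))
      show ?thesis
        using finite_measure_finite_Union[OF _ _ disj] S that(2) un by auto
    qed
    have \<omega>S: "\<omega> A = measure P A - measure Q A" if "A \<in> sets ?B" for A
      unfolding P_def Q_def by (rule Jordan_decomposition[OF sm that])
    have sum: "(\<Sum>i<n. \<omega> (S i)) = \<omega> K"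
    proof -
      have "K \<in> sets ?B" using sets.top[of ?B] by simp
      then show ?thesis
        using fin_un[OF PQ(1)] fin_un[OF PQ(2)] S by (simp add: \<omega>S sum_subtractf) (simp add: P_def Q_def)
    qed
    have abs: "(\<Sum>i<n. \<bar>\<omega> (S i)\<bar>) \<le> V"
    proof -
      have "(\<Sum>i<n. \<bar>\<omega> (S i)\<bar>) \<le> (\<Sum>i<n. measure P (S i) + measure Q (S i))"
      proof (rule sum_mono)
        fix i
        show "\<bar>\<omega> (S i)\<bar> \<le> measure P (S i) + measure Q (S i)"
          using \<omega>S[OF S[of i]] measure_nonneg[of P "S i"] measure_nonneg[of Q "S i"] by linarith
      qed
      also have "\<dots> = V"
        using fin_un[OF PQ(1)] fin_un[OF PQ(2)] by (simp add: V_def sum.distrib P_def Q_def)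
      finally show ?thesis .
    qed
    have "\<bar>(\<Sum>i<n. \<omega> (S i) * l1_kernel N (x i) a) - 1\<bar> \<le> \<eta>" if a: "a \<in> K" for a
    proof -
      have "\<bar>signed_integral ?B \<omega> (\<lambda>x. l1_kernel N x a) - (\<Sum>i<n. l1_kernel N (x i) a * \<omega> (S i))\<bar>
          \<le> r * (measure (positive_variation ?B \<omega>) (space ?B)
            + measure (positive_variation ?B (\<lambda>A. - \<omega> A)) (space ?B))"
        by (rule signed_integral_near_step_function[where C = 1])
          (use sm l1_kernel_measurable[OF KM] l1_kernel_nonneg l1_kernel_le_1 S disj un near in auto)
      then have "\<bar>1 - (\<Sum>i<n. l1_kernel N (x i) a * \<omega> (S i))\<bar> \<le> r * V"
        by (simp add: int[OF a] V_def P_def Q_def)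
      then show ?thesis using r(2) by (simp add: mult.commute abs_minus_commute)
    qed
    then show "\<exists>(n :: nat) x v. (\<forall>i<n. x i \<in> K) \<and> (\<Sum>i<n. v i) = \<omega> K \<and> (\<Sum>i<n. \<bar>v i\<bar>) \<le> V \<and>
        (\<forall>a\<in>K. \<bar>(\<Sum>i<n. v i * l1_kernel N (x i) a) - 1\<bar> \<le> \<eta>)"
      using xK sum abs by (intro exI[of _ n] exI[of _ x] exI[of _ "\<lambda>i. \<omega> (S i)"]) auto
  qed
qed

text \<open>Only the total mass is compared between weight measures, through their discretisations;
  this is all that the description in \<open>mag\<close> asks for.\<close>

lemma mag_eq:
  assumes "K \<in> l1.nonempty_compacts N" "weight_measure N K \<omega>"
  shows "mag N K = \<omega> K"
  unfolding mag_def
proof (rule the_equality)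
  fix m assume "\<exists>\<omega>. weight_measure N K \<omega> \<and> m = \<omega> K"
  then show "m = \<omega> K"
    using approx_l1_weighting_weight_measure[OF assms(1)] assms(2) approx_l1_weighting_unique by metis
qed (use assms in auto)

section \<open>Weight measures of finite sets\<close>

lemma finite_nonempty_compacts:
  "finite F \<Longrightarrow> F \<noteq> {} \<Longrightarrow> F \<subseteq> l1_space N \<Longrightarrow> F \<in> l1.nonempty_compacts N"
  by (simp add: l1.nonempty_compacts_def finite_imp_compactin)

lemma sets_l1_borel_finite:
  assumes F: "finite F" "F \<subseteq> l1_space N" and A: "A \<subseteq> F"
  shows "A \<in> sets (l1_borel N F)"
proof -
  have "compactin (l1.mtopology N) (F - A)" using F by (intro finite_imp_compactin) auto
  then have "closedin (l1.mtopology N) (F - A)"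
    by (rule compactin_imp_closedin[OF l1.Hausdorff_space_mtopology])
  then have "F \<inter> (l1_space N - (F - A)) \<in> sets (l1_borel N F)"
    by (intro l1_borel_openin) (metis l1.topspace_mtopology openin_diff openin_topspace)
  moreover have "F \<inter> (l1_space N - (F - A)) = A" using F A by auto
  ultimately show ?thesis by simp
qed

lemma (in finite_l1_weighting) weight_measure:
  "weight_measure N F (\<lambda>A. \<Sum>p\<in>F. w p * indicator A p)"
proof -
  let ?\<omega> = "\<lambda>A. \<Sum>p\<in>F. w p * indicator A p"
  have sm: "finite_signed_measure (l1_borel N F) ?\<omega>"
    unfolding finite_signed_measure_def
  proof (intro conjI allI impI)
    fix A :: "nat \<Rightarrow> (nat \<Rightarrow> real) set"
    assume "disjoint_family A"
    then have "(\<lambda>i. indicator (A i) p :: real) sums indicator (\<Union>i. A i) p" for p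
      by (intro indicator_sums) (auto simp: disjoint_family_on_def)
    then show "(\<lambda>i. ?\<omega> (A i)) sums ?\<omega> (\<Union>i. A i)"
      by (intro sums_sum sums_mult)
  qed simp
  have "signed_integral (l1_borel N F) ?\<omega> (\<lambda>x. l1_kernel N x a) = 1" if a: "a \<in> F" for a
  proof -
    \<comment> \<open>On the partition of \<open>F\<close> into singletons the kernel is itself a
      step function, hence the error 0.\<close>
    have "\<bar>signed_integral (l1_borel N F) ?\<omega> (\<lambda>x. l1_kernel N x a)
        - (\<Sum>q\<in>F. l1_kernel N q a * ?\<omega> {q})\<bar>
        \<le> 0 * (measure (positive_variation (l1_borel N F) ?\<omega>) (space (l1_borel N F))
          + measure (positive_variation (l1_borel N F) (\<lambda>A. - ?\<omega> A)) (space (l1_borel N F)))"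
      by (rule signed_integral_near_step_function[where C = 1])
        (use sm finite l1_kernel_measurable[OF l1_space] l1_kernel_nonneg l1_kernel_le_1
          sets_l1_borel_finite[OF finite l1_space] in \<open>auto simp: disjoint_family_on_def\<close>)
    moreover have "?\<omega> {q} = w q" if "q \<in> F" for q
      using finite that by (simp add: indicator_def if_distrib cong: if_cong)
    ultimately have "signed_integral (l1_borel N F) ?\<omega> (\<lambda>x. l1_kernel N x a)
        = (\<Sum>q\<in>F. l1_kernel N q a * w q)" by simp
    then show ?thesis using weighting[OF a] by (simp add: mult.commute)
  qed
  then show ?thesis using sm by (simp add: weight_measure_def l1_kernel_def)
qed

lemma ex_finite_l1_weighting:
  assumes "finite F" "F \<noteq> {}" "F \<subseteq> l1_space N"
  shows "\<exists>w. finite_l1_weighting N F w"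
  using ex_l1_kernel_solution[of F N "\<lambda>_. 1"] assms by (auto simp: finite_l1_weighting_def)

lemma finite_mag_domain:
  assumes "finite F" "F \<noteq> {}" "F \<subseteq> l1_space N"
  shows "F \<in> mag_domain N"
  using ex_finite_l1_weighting[OF assms] finite_nonempty_compacts[OF assms]
    finite_l1_weighting.weight_measure by (auto simp: mag_domain_def)

section \<open>Continuity at finite sets\<close>

lemma mag_near_finite:
  assumes F: "finite F" "F \<noteq> {}" "F \<subseteq> l1_space N" and "0 < e"
  shows "\<exists>\<delta>>0. \<forall>K\<in>mag_domain N. l1.hausdorff_dist N F K < \<delta> \<longrightarrow> \<bar>mag N K - mag N F\<bar> < e"
proof -
  obtain w where "finite_l1_weighting N F w" using ex_finite_l1_weighting[OF F] by blast
  then interpret finite_l1_weighting N F w .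
  have FK: "F \<in> l1.nonempty_compacts N" by (rule finite_nonempty_compacts[OF F])
  have "mag N F = M" using mag_eq[OF FK weight_measure] by (simp add: M_def)
  obtain \<delta> where \<delta>: "0 < \<delta>" "\<And>K m V. approx_l1_weighting N K m V \<Longrightarrow>
    (\<forall>p\<in>F. \<exists>a\<in>K. l1_dist N p a < \<delta>) \<Longrightarrow> (\<forall>a\<in>K. \<exists>p\<in>F. l1_dist N a p < \<delta>) \<Longrightarrow> \<bar>m - M\<bar> < e"
    using approx_l1_weighting_near[OF \<open>0 < e\<close>] by blast
  have "\<bar>mag N K - M\<bar> < e" if K: "K \<in> mag_domain N" and dist: "l1.hausdorff_dist N F K < \<delta>" for K
  proof -
    obtain \<omega> where KK: "K \<in> l1.nonempty_compacts N" and \<omega>: "weight_measure N K \<omega>"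
      using K by (auto simp: mag_domain_def)
    obtain V where aw: "approx_l1_weighting N K (mag N K) V"
      using approx_l1_weighting_weight_measure[OF KK \<omega>] mag_eq[OF KK \<omega>] by auto
    show ?thesis
    proof (rule \<delta>(2)[OF aw])
      \<comment> \<open>The room between the Hausdorff distance and \<delta> is the tolerance
        granted to \<open>hausdorff_dist_approx\<close>.\<close>
      show "\<forall>p\<in>F. \<exists>a\<in>K. l1_dist N p a < \<delta>"
        using l1.hausdorff_dist_approx[OF FK KK, of _ "\<delta> - l1.hausdorff_dist N F K"] dist by simp
      show "\<forall>a\<in>K. \<exists>p\<in>F. l1_dist N a p < \<delta>"
        using l1.hausdorff_dist_approx[OF KK FK, of _ "\<delta> - l1.hausdorff_dist N F K"] dist
        by (simp add: l1.hausdorff_dist_commute[of N K F])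
    qed
  qed
  then show ?thesis using \<delta>(1) \<open>mag N F = M\<close> by auto
qed

text \<open>The subspace \<open>A\<close> is left open to cover both claims: all of
  \<open>mag_domain N\<close>, and the non-empty finite sets.\<close>

lemma topcontinuous_at_mag:
  assumes F: "finite F" "F \<noteq> {}" "F \<subseteq> l1_space N" and A: "A \<subseteq> mag_domain N" "F \<in> A"
  shows "topcontinuous_at (subtopology (l1.hausdorff_topology N) A) euclideanreal (mag N) F"
proof -
  interpret H: Metric_space "l1.nonempty_compacts N" "l1.hausdorff_dist N"
    by (rule l1.Metric_space_hausdorff_dist)
  have FK: "F \<in> l1.nonempty_compacts N" by (rule finite_nonempty_compacts[OF F])
  show ?thesis
    unfolding topcontinuous_at_def l1.hausdorff_topology_def
  proof (intro conjI allI impI)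
    show "F \<in> topspace (subtopology H.mtopology A)" using FK A by simp
    fix V assume V: "openin euclideanreal V \<and> mag N F \<in> V"
    then obtain e where e: "0 < e" "ball (mag N F) e \<subseteq> V"
      by (auto simp: open_contains_ball)
    obtain \<delta> where \<delta>: "0 < \<delta>"
        "\<And>K. K \<in> mag_domain N \<Longrightarrow> l1.hausdorff_dist N F K < \<delta> \<Longrightarrow> \<bar>mag N K - mag N F\<bar> < e"
      using mag_near_finite[OF F e(1)] by blast
    have "openin (subtopology H.mtopology A) (A \<inter> H.mball F \<delta>)"
      by (rule openin_subtopology_Int2) (rule H.openin_mball)
    moreover have "F \<in> A \<inter> H.mball F \<delta>" using FK A \<delta>(1) by simp
    moreover have "mag N K \<in> V" if "K \<in> A \<inter> H.mball F \<delta>" for K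
      using that A \<delta>(2)[of K] e(2) by (auto simp: dist_real_def abs_minus_commute subset_eq)
    ultimately show "\<exists>U. openin (subtopology H.mtopology A) U \<and> F \<in> U \<and> (\<forall>K\<in>U. mag N K \<in> V)"
      by blast
  qed simp
qed

theorem theorem6p3:
  fixes N :: nat
  shows "(\<forall>F. F \<subseteq> l1_space N \<longrightarrow> finite F \<longrightarrow> F \<noteq> {} \<longrightarrow>
            topcontinuous_at (subtopology (l1.hausdorff_topology N) (mag_domain N))
              euclideanreal (mag N) F)
       \<and> continuous_map
           (subtopology (l1.hausdorff_topology N) {F. F \<subseteq> l1_space N \<and> finite F \<and> F \<noteq> {}})
           euclideanreal (mag N)"
  unfolding continuous_map_eq_topcontinuous_at
  by (intro conjI allI impI ballI topcontinuous_at_mag) (auto intro: finite_mag_domain)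

end
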